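(* Let $\Phi\in L^1(\mu)$. The operator $\mathbb{H}_{\Phi,\mu}$ is bounded in $PW$ if and only if the integral operator $\mathbb{K}_{\Phi,\mu}$ is bounded in $PW$. In this case, for all $f\in PW$, $$(\mathbb{H}_{\Phi,\mu}f)(t)=\int_{-\infty}^\infty K_{\Phi,\mu}(t,x)f(x)\,dx,\quad t\in\mathbb{R}.$$
   Context: $\mu$ is a regular positive Borel measure on $(0,\infty)$ and $\Phi:(0,\infty)\to\mathbb{C}$ is $\mu$-measurable. The Hausdorff operator is $(\mathbb{H}_{\Phi,\mu}F)(z)=\int_0^\infty \Phi(u)F(z/u)\,d\mu(u)$, $z\in\mathbb{C}$. $PW=PW_\pi$ is the space of entire functions of exponential type (at most) $\pi$ whose restrictions to $\mathbb{R}$ belong to $L^2(\mathbb{R})$, with the $L^2(\mathbb{R})$ norm; its elements are identified with their restrictions to $\mathbb{R}$. $\mathbb{K}_{\Phi,\mu}$ is the integral operator $(\mathbb{K}_{\Phi,\mu}f)(t)=\int_{-\infty}^\infty K_{\Phi,\mu}(t,x)f(x)\,dx$ with kernel $K_{\Phi,\mu}(t,x)=\int_0^\infty\Phi(u)\,\mathrm{sinc}\left(\frac tu-x\right)d\mu(u)$, $t,x\in\mathbb{R}$, where $\mathrm{sinc}(z)=\frac{\sin(\pi z)}{\pi z}$, $\mathrm{sinc}(0)=1$. *)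

theory Defs
  imports "HOL-Complex_Analysis.Complex_Analysis"
begin

text \<open>
  A measure on \<open>(0,\<infinity>)\<close> is a \<^typ>\<open>real measure\<close> whose underlying space is \<^term>\<open>{0<..} :: real set\<close>.
  Finiteness on compact sets is not required. For Borel measures on \<open>(0,\<infinity>)\<close> that are finite on
  compact sets the two regularity conditions hold automatically, so measures that are regular in
  that other common sense are covered as well.
\<close>

definition regular_borel_measure :: "real measure \<Rightarrow> bool" where
  "regular_borel_measure \<mu> \<longleftrightarrow>
     sets \<mu> = sets (restrict_space borel {0<..}) \<and>
     (\<forall>A\<in>sets \<mu>.
        emeasure \<mu> A = (INF U\<in>{U. open U \<and> A \<subseteq> U \<and> U \<subseteq> {0<..}}. emeasure \<mu> U) \<and>
        emeasure \<mu> A = (SUP C\<in>{C. compact C \<and> C \<subseteq> A}. emeasure \<mu> C))"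

definition PW :: "(complex \<Rightarrow> complex) set" where
  "PW = {F. F holomorphic_on UNIV \<and>
            (\<forall>\<epsilon>>0. \<exists>C. \<forall>z. norm (F z) \<le> C * exp ((pi + \<epsilon>) * norm z)) \<and>
            integrable lborel (\<lambda>x::real. (norm (F (complex_of_real x)))\<^sup>2)}"

definition real_restriction :: "(complex \<Rightarrow> complex) \<Rightarrow> real \<Rightarrow> complex" where
  "real_restriction F = (\<lambda>x. F (complex_of_real x))"

definition L2_norm_real :: "(real \<Rightarrow> complex) \<Rightarrow> real" where
  "L2_norm_real f = sqrt (LINT x|lborel. (norm (f x))\<^sup>2)"

text \<open>
  Integrals against \<open>\<mu>\<close> are taken over the completion, so that \<open>\<Phi>\<close> only has to be
  \<open>\<mu>\<close>-measurable rather than Borel measurable.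
\<close>

definition hausdorff_op ::
  "(real \<Rightarrow> complex) \<Rightarrow> real measure \<Rightarrow> (complex \<Rightarrow> complex) \<Rightarrow> complex \<Rightarrow> complex" where
  "hausdorff_op \<Phi> \<mu> F z = (LINT u|completion \<mu>. \<Phi> u * F (z / complex_of_real u))"

definition nsinc :: "complex \<Rightarrow> complex" where
  "nsinc z = (if z = 0 then 1 else sin (of_real pi * z) / (of_real pi * z))"

definition K_kernel :: "(real \<Rightarrow> complex) \<Rightarrow> real measure \<Rightarrow> real \<Rightarrow> real \<Rightarrow> complex" where
  "K_kernel \<Phi> \<mu> t x = (LINT u|completion \<mu>. \<Phi> u * nsinc (complex_of_real (t / u - x)))"

definition K_op ::
  "(real \<Rightarrow> complex) \<Rightarrow> real measure \<Rightarrow> (real \<Rightarrow> complex) \<Rightarrow> real \<Rightarrow> complex" where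
  "K_op \<Phi> \<mu> f t = (LINT x|lborel. K_kernel \<Phi> \<mu> t x * f x)"

text \<open>
  Boundedness of an operator in \<^const>\<open>PW\<close> includes that its defining integrals converge
  absolutely and that it maps the space into itself. The integrability clauses are needed because
  the Bochner integral of a non-integrable function is \<open>0\<close> by convention.
\<close>

definition hausdorff_bounded_in_PW :: "(real \<Rightarrow> complex) \<Rightarrow> real measure \<Rightarrow> bool" where
  "hausdorff_bounded_in_PW \<Phi> \<mu> \<longleftrightarrow>
     (\<forall>F\<in>PW. \<forall>z. integrable (completion \<mu>) (\<lambda>u. \<Phi> u * F (z / complex_of_real u))) \<and>
     (\<forall>F\<in>PW. hausdorff_op \<Phi> \<mu> F \<in> PW) \<and>
     (\<exists>C. \<forall>F\<in>PW. L2_norm_real (real_restriction (hausdorff_op \<Phi> \<mu> F))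
                   \<le> C * L2_norm_real (real_restriction F))"

text \<open>
  \<^const>\<open>K_op\<close> produces functions on the real line, so here the elements of \<^const>\<open>PW\<close> are
  identified with their restrictions.
\<close>

definition K_bounded_in_PW :: "(real \<Rightarrow> complex) \<Rightarrow> real measure \<Rightarrow> bool" where
  "K_bounded_in_PW \<Phi> \<mu> \<longleftrightarrow>
     (\<forall>t x. integrable (completion \<mu>) (\<lambda>u. \<Phi> u * nsinc (complex_of_real (t / u - x)))) \<and>
     (\<forall>f\<in>real_restriction ` PW. \<forall>t. integrable lborel (\<lambda>x. K_kernel \<Phi> \<mu> t x * f x)) \<and>
     (\<forall>f\<in>real_restriction ` PW. K_op \<Phi> \<mu> f \<in> real_restriction ` PW) \<and>
     (\<exists>C. \<forall>f\<in>real_restriction ` PW. L2_norm_real (K_op \<Phi> \<mu> f) \<le> C * L2_norm_real f)"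

end

theory Submission
  imports
    Defs
    "HOL-Real_Asymp.Real_Asymp"
    "HOL-Probability.Sinc_Integral"
begin

text \<open>
The two operators agree on the real line because of the reproducing formula: a function \<open>F\<close> in \<^const>\<open>PW\<close> satisfies
\<open>F s = \<integral> nsinc (s - x) * F x dx\<close> (lemma \<open>PW_reproducing\<close>). Taking \<open>s = t / u\<close>, integrating against \<open>\<Phi> u\<close> and exchanging
the integrals, which is legitimate for integrable \<open>\<Phi>\<close> because \<open>nsinc\<close> and \<open>F\<close> are square integrable, gives the
values of the Hausdorff operator at all real points (lemma \<open>K_op_eq_hausdorff_op\<close>). So the two operators have the same
restrictions to the real line and the same norms, and a bounded Hausdorff operator gives a bounded integral operator.

The converse needs more: boundedness of the integral operator says nothing about complex points, whereas the Hausdorff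
operator must converge at all of them, and \<open>F (z / u)\<close> with \<open>u < 1\<close> may grow faster than exponential type \<open>pi\<close>
permits. The key fact is that \<open>\<Phi>\<close> vanishes almost everywhere on \<open>(0, 1)\<close> as soon as the operator maps \<^const>\<open>PW\<close> into itself
on the real line (lemma \<open>weight_vanishes_below_one\<close>). Indeed, the dilation by \<open>u\<close> moves a frequency \<open>\<xi>\<close> to \<open>\<xi> / u\<close>,
which exceeds \<open>pi\<close> when \<open>\<xi>\<close> is slightly below \<open>pi\<close> and \<open>u < 1\<close>. Testing the image of nearly pure frequencies against
kernels whose spectrum is a thin-edged trapezoid above \<open>pi\<close> shows that the integral of \<open>\<Phi>\<close> over every interval
\<open>[p, q]\<close> with \<open>0 < p \<le> q < 1\<close> is 0. Once \<open>\<Phi>\<close> is supported on \<open>[1, \<infinity>)\<close>, the operator is an average of contracting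
dilations and preserves entire functions of exponential type.

All Fourier-analytic facts come from contour integration. A Phragmen-Lindeloef argument bounds a function of \<^const>\<open>PW\<close> by
a multiple of $e^{a |\mathrm{Im}\, z|}$ for each \<open>a > pi\<close> (lemma \<open>PW_bound\<close>). With this bound, a residue computation shows
that the integral of \<open>F x * (cos (a * x) - cos (b * x)) / x\<^sup>2\<close> is \<open>pi * (b - a) * F 0\<close> if \<open>a\<close> and \<open>b\<close> are at least the type
of \<open>F\<close> (lemma \<open>integral_times_vp_kernel\<close>). This identity yields both the reproducing formula and the properties of the
test kernels.
\<close>

section \<open>A Phragmen-Lindeloef principle for exponential type\<close>

text \<open>
The quadrant $\{\mathrm{Re}\,z, \mathrm{Im}\,z \ge 0\}$ is the image of the sector of half-angle $\pi/8$ around the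
positive axis under $s \mapsto (1 + i) s^2$, and $\sqrt 2 - 1 = \tan(\pi/8)$. In the sector the cube has an
argument of at most $3\pi/8$ in absolute value, so $\mathrm{Re}\,s^3$ is comparable to $|s|^3$ and
$e^{-\epsilon s^3}$ beats every function of growth $e^{B|s|^2}$. Passing to $s$ avoids a branch of $z^{3/2}$.
\<close>

lemma wedge_square_boundary:
  assumes "\<bar>Im s\<bar> = (sqrt 2 - 1) * Re s"
  obtains r where "r \<ge> 0" "(1 + \<i>) * s\<^sup>2 = of_real r \<or> (1 + \<i>) * s\<^sup>2 = \<i> * of_real r"
proof -
  define t where "t = sqrt 2 - 1"
  have t: "t > 0" "t^2 = 1 - 2*t" by (auto simp: t_def power2_eq_square algebra_simps)
  have r0: "Re s \<ge> 0" using assms t unfolding t_def[symmetric] by (metis abs_ge_zero zero_le_mult_iff not_less)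
  have "Im s = t * Re s \<or> Im s = - (t * Re s)" using assms unfolding t_def[symmetric] by linarith
  moreover have "t*(t*(Re s * Re s)) = (1-2*t) * (Re s * Re s)" using t(2) by (simp add: power2_eq_square)
  ultimately have "(1 + \<i>) * s\<^sup>2 = of_real (4 * t * (Re s)^2) \<or> (1 + \<i>) * s\<^sup>2 = \<i> * of_real (4 * t * (Re s)^2)"
    by (auto simp: complex_eq_iff power2_eq_square algebra_simps)
  then show ?thesis using that[of "4 * t * (Re s)^2"] t by auto
qed

lemma wedge_cube_Re:
  assumes "\<bar>Im s\<bar> \<le> (sqrt 2 - 1) * Re s"
  shows "Re s \<ge> 0" "Re (s^3) \<ge> (Re s)^3 / 4" "norm s ^ 2 \<le> 2 * (Re s)^2"
proof -
  define t where "t = sqrt 2 - 1"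
  have t: "t > 0" by (auto simp: t_def)
  have "sqrt 2 \<le> 3/2" by (rule real_le_lsqrt) (auto simp: power2_eq_square)
  then have t': "t \<le> 1/2" by (simp add: t_def)
  show r0: "Re s \<ge> 0" using assms t unfolding t_def[symmetric] by (smt (verit) mult_pos_neg)
  have "(Im s)^2 \<le> (t * Re s)^2" using assms unfolding t_def[symmetric] by (metis abs_ge_zero power2_abs power_mono)
  also have "\<dots> = t^2 * (Re s)^2" by (simp add: power_mult_distrib)
  also have "\<dots> \<le> (1/2)^2 * (Re s)^2" using t t' by (intro mult_right_mono power_mono) auto
  finally have im: "(Im s)^2 \<le> (Re s)^2/4" by (simp add: power2_eq_square)
  have "Re (s^3) = Re s * ((Re s)^2 - 3 * (Im s)^2)"
    by (simp add: power3_eq_cube power2_eq_square algebra_simps)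
  also have "\<dots> \<ge> Re s * ((Re s)^2/4)" using im r0 by (intro mult_left_mono) auto
  finally show "Re (s^3) \<ge> (Re s)^3 / 4" by (simp add: power3_eq_cube power2_eq_square)
  show "norm s ^ 2 \<le> 2 * (Re s)^2" using im by (simp add: cmod_power2) (smt (verit) zero_le_power2)
qed

text \<open>
The maximum principle on the sector truncated at \<open>Re s = R\<close>, applied to
$f((1+i)s^2)\,e^{-\epsilon s^3}$: the slanted sides are mapped to the two half-axes, and on the vertical side the
damping factor wins once \<open>R\<close> is large. Then \<open>\<epsilon>\<close> tends to 0.
\<close>

lemma phragmen_lindelof_quadrant:
  fixes f :: "complex \<Rightarrow> complex"
  assumes hol: "f holomorphic_on UNIV"
    and growth: "\<And>z. norm (f z) \<le> C * exp (B * norm z)"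
    and M: "M > 0"
    and real_axis: "\<And>x. x \<ge> 0 \<Longrightarrow> norm (f (of_real x)) \<le> M"
    and imag_axis: "\<And>y. y \<ge> 0 \<Longrightarrow> norm (f (\<i> * of_real y)) \<le> M"
    and z: "Re z \<ge> 0" "Im z \<ge> 0"
  shows "norm (f z) \<le> M"
proof -
  define t where "t = sqrt 2 - 1"
  have t: "t > 0" "t^2 = 1 - 2*t" by (auto simp: t_def power2_eq_square algebra_simps)
  define s where "s = csqrt (z / (1 + \<i>))"
  have s2: "s^2 = z / (1 + \<i>)" by (simp add: s_def)
  have ni: "1 + \<i> \<noteq> 0" by (simp add: complex_eq_iff)
  have zs: "z = (1 + \<i>) * s^2" using s2 ni by simp
  have Res: "Re s \<ge> 0" using csqrt_principal[of "z / (1 + \<i>)"] by (auto simp: s_def)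
  \<comment> \<open>\<open>(1 + \<i>) * s\<^sup>2\<close> lies in the quadrant iff \<open>2 * Re s * \<bar>Im s\<bar> \<le> (Re s)\<^sup>2 - (Im s)\<^sup>2\<close>, and \<open>t\<close> is the
    positive root of \<open>2 * t = 1 - t\<^sup>2\<close>.\<close>
  have sw: "\<bar>Im s\<bar> \<le> t * Re s"
  proof (rule ccontr)
    assume "\<not> ?thesis"
    then have a: "\<bar>Im s\<bar> > t * Re s" by simp
    define p where "p = \<bar>Im s\<bar>"
    have "\<bar>2 * Re s * Im s\<bar> \<le> (Re s)^2 - (Im s)^2"
      using z unfolding zs by (auto simp: power2_eq_square algebra_simps abs_if)
    then have 1: "2 * Re s * p \<le> (Re s)^2 - p^2" using Res by (simp add: p_def abs_mult)
    have 2: "(t * Re s)^2 < p^2" using a t Res unfolding p_def by (intro power_strict_mono) auto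
    have 3: "2 * Re s * (t * Re s) \<le> 2 * Re s * p" using a Res unfolding p_def by (intro mult_left_mono) auto
    have "(t * Re s)^2 + 2 * Re s * (t * Re s) = (Re s)^2 * (t^2 + 2*t)" by (simp add: power2_eq_square algebra_simps)
    also have "\<dots> = (Re s)^2" using t(2) by simp
    finally show False using 1 2 3 by linarith
  qed
  have C0: "C \<ge> 0" using growth[of 0] norm_ge_zero[of "f 0"] by simp (meson order_trans norm_ge_zero)
  have B': "B * x \<le> \<bar>B\<bar> * x" if "x \<ge> 0" for x :: real using that by (intro mult_right_mono) auto
  have key: "norm (f z) * exp (- (\<epsilon> * Re (s^3))) \<le> M" if "\<epsilon> > 0" for \<epsilon>
  proof -
    define g where "g = (\<lambda>s. f ((1 + \<i>) * s^2) * exp (- (of_real \<epsilon> * s^3)))"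
    have ng: "norm (g s) = norm (f ((1 + \<i>) * s^2)) * exp (- (\<epsilon> * Re (s^3)))" for s
      by (simp add: g_def norm_mult)
    have hg: "g holomorphic_on A" for A
      unfolding g_def using holomorphic_on_subset[OF hol subset_UNIV]
      by (intro holomorphic_intros holomorphic_on_compose_gen[OF _ hol, unfolded o_def]) auto
    have "((\<lambda>R. C * exp (\<bar>B\<bar> * 4 * R^2 - \<epsilon> * (R^3/4))) \<longlongrightarrow> 0) at_top"
      using that by real_asymp
    then have "eventually (\<lambda>R. C * exp (\<bar>B\<bar> * 4 * R^2 - \<epsilon> * (R^3/4)) < M) at_top"
      using M by (rule order_tendstoD)
    then have "eventually (\<lambda>R. C * exp (\<bar>B\<bar> * 4 * R^2 - \<epsilon> * (R^3/4)) < M \<and> R > Re s) at_top"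
      by (intro eventually_conj eventually_gt_at_top)
    then obtain R where R: "C * exp (\<bar>B\<bar> * 4 * R^2 - \<epsilon> * (R^3/4)) < M" "R > Re s"
      using eventually_happens'[OF trivial_limit_at_top_linorder] by blast
    define T where "T = {s. \<bar>Im s\<bar> \<le> t * Re s \<and> Re s \<le> R}"
    have clT: "closed T" unfolding T_def
      by (intro closed_Collect_conj closed_Collect_le continuous_intros)
    have bT: "bounded T"
    proof (rule boundedI)
      fix x assume "x \<in> T"
      then have "Re x \<ge> 0" "norm x ^ 2 \<le> 2 * (Re x)^2" "Re x \<le> R"
        using wedge_cube_Re[of x] by (auto simp: T_def t_def)
      then have "norm x ^ 2 \<le> 2 * R^2" by (smt (verit) power_mono)
      then show "norm x \<le> sqrt (2 * R^2)" by (rule real_le_rsqrt)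
    qed
    have "open {s. \<bar>Im s\<bar> < t * Re s \<and> Re s < R}"
      by (intro open_Collect_conj open_Collect_less continuous_intros)
    then have intT: "{s. \<bar>Im s\<bar> < t * Re s \<and> Re s < R} \<subseteq> interior T"
      by (rule interior_maximal[rotated]) (auto simp: T_def)
    have "norm (g s) \<le> M"
    proof (rule maximum_modulus_frontier[of g T])
      show "continuous_on (closure T) g" using hg by (rule holomorphic_on_imp_continuous_on)
      fix w assume "w \<in> frontier T"
      then have w: "w \<in> T" "w \<notin> interior T" using clT by (auto simp: frontier_def)
      then have wT: "\<bar>Im w\<bar> \<le> t * Re w" "Re w \<le> R" by (auto simp: T_def)
      note cube = wedge_cube_Re[OF wT(1)[unfolded t_def]]
      consider "\<bar>Im w\<bar> = t * Re w" | "Re w = R" using w(2) wT intT by (smt (verit) mem_Collect_eq subsetD)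
      then show "norm (g w) \<le> M"
      proof cases
        case 1
        then obtain r where "r \<ge> 0" "(1 + \<i>) * w\<^sup>2 = of_real r \<or> (1 + \<i>) * w\<^sup>2 = \<i> * of_real r"
          using wedge_square_boundary t_def by metis
        then have *: "norm (f ((1 + \<i>) * w^2)) \<le> M" using real_axis imag_axis by auto
        have "Re (w^3) \<ge> 0" using cube by (smt (verit) zero_le_power divide_nonneg_nonneg)
        then have "exp (- (\<epsilon> * Re (w^3))) \<le> 1" using that by simp
        then have "norm (g w) \<le> M * 1" unfolding ng using * M by (intro mult_mono) auto
        then show ?thesis by simp
      next
        case 2
        have "norm (1 + \<i>) = sqrt 2" by (simp add: cmod_def)
        then have "norm ((1 + \<i>) * w^2) = sqrt 2 * norm w ^ 2"
          by (simp add: norm_mult norm_power)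
        also have "\<dots> \<le> 2 * (2 * R^2)" using cube(3) 2
          by (intro mult_mono) (auto intro: real_le_lsqrt)
        finally have nz: "norm ((1 + \<i>) * w^2) \<le> 4 * R^2" by simp
        have "B * norm ((1 + \<i>) * w^2) \<le> \<bar>B\<bar> * norm ((1 + \<i>) * w^2)" by (rule B') simp
        also have "\<dots> \<le> \<bar>B\<bar> * (4 * R^2)" using nz by (intro mult_left_mono) auto
        finally have nz': "B * norm ((1 + \<i>) * w^2) \<le> \<bar>B\<bar> * 4 * R^2" by simp
        have "norm (g w) \<le> (C * exp (\<bar>B\<bar> * 4 * R^2)) * exp (- (\<epsilon> * (R^3/4)))"
          unfolding ng
          using cube(2) that C0 2
          by (intro mult_mono order_trans[OF growth]) (use nz' in auto)
        also have "\<dots> = C * exp (\<bar>B\<bar> * 4 * R^2 - \<epsilon> * (R^3/4))" by (simp add: mult.assoc exp_add[symmetric])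
        finally show ?thesis using R by linarith
      qed
    qed (use hg bT sw R in \<open>auto simp: T_def\<close>)
    then show ?thesis by (simp add: ng zs)
  qed
  have "((\<lambda>\<epsilon>. norm (f z) * exp (- (\<epsilon> * Re (s^3)))) \<longlongrightarrow> norm (f z) * exp (- (0 * Re (s^3)))) (at_right 0)"
    by (intro tendsto_intros)
  then have "norm (f z) * exp (- (0 * Re (s^3))) \<le> M"
    by (rule tendsto_upperbound) (use key in \<open>auto simp: eventually_at_right_less eventually_at_filter\<close>)
  then show ?thesis by simp
qed

lemma norm_exp_i_mult: "norm (exp (\<i> * of_real a * z)) = exp (- (a * Im z))"
  by (simp add: norm_exp_eq_Re)

text \<open>
In each of the four quadrants multiplication by $e^{iaz}$ or $e^{-iaz}$ keeps the function bounded on the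
real half-axis and cancels the growth on the imaginary half-axis.
\<close>

lemma phragmen_lindelof_exponential_type:
  fixes f :: "complex \<Rightarrow> complex"
  assumes hol: "f holomorphic_on UNIV"
    and growth: "\<And>z. norm (f z) \<le> C * exp (a * norm z)"
    and a: "a \<ge> 0" and M: "M > 0" "C \<le> M"
    and bounded: "\<And>x. norm (f (of_real x)) \<le> M"
  shows "norm (f z) \<le> M * exp (a * \<bar>Im z\<bar>)"
proof -
  have C0: "C \<ge> 0" using growth[of 0] norm_ge_zero[of "f 0"] by simp (meson order_trans norm_ge_zero)
  \<comment> \<open>The rotation \<open>\<omega>\<close> carries the first quadrant to the one under consideration and the sign of \<open>b\<close>
    makes the exponential factor decay on its imaginary half-axis.\<close>
  have main: "norm (f (\<omega> * w)) * exp (- (b * Im (\<omega> * w))) \<le> M"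
    if \<omega>: "norm \<omega> = 1" and bab: "\<bar>b\<bar> = a" and w: "Re w \<ge> 0" "Im w \<ge> 0"
      and axes: "Im \<omega> = 0 \<and> b * Re \<omega> \<ge> 0 \<or> Re \<omega> = 0 \<and> b * Im \<omega> \<ge> 0" for \<omega> b w
  proof -
    define g where "g = (\<lambda>w. f (\<omega> * w) * exp (\<i> * of_real b * (\<omega> * w)))"
    have ng: "norm (g w) = norm (f (\<omega> * w)) * exp (- (b * Im (\<omega> * w)))" for w
      unfolding g_def norm_mult norm_exp_i_mult ..
    have gr: "norm (f (\<omega> * w)) \<le> C * exp (a * norm w)" for w
      using growth[of "\<omega> * w"] \<omega> by (simp add: norm_mult)
    have imb: "- (b * Im (\<omega> * w)) \<le> a * norm w" for w
    proof -
      have "- (b * Im (\<omega> * w)) \<le> \<bar>b * Im (\<omega> * w)\<bar>" by simp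
      also have "\<dots> = a * \<bar>Im (\<omega> * w)\<bar>" using bab by (simp add: abs_mult)
      also have "\<dots> \<le> a * norm (\<omega> * w)" using a by (intro mult_left_mono abs_Im_le_cmod)
      finally show ?thesis using \<omega> by (simp add: norm_mult)
    qed
    have ax_real: "norm (g w) \<le> M" if "Im (\<omega> * w) = 0" for w
    proof -
      have "\<omega> * w = of_real (Re (\<omega> * w))" using that by (simp add: complex_eq_iff)
      then have "norm (f (\<omega> * w)) \<le> M" using bounded by metis
      then show ?thesis unfolding ng that by simp
    qed
    have ax_imag: "norm (g w) \<le> M" if "b * Im (\<omega> * w) = a * norm w" for w
    proof -
      have "norm (g w) \<le> C * exp (a * norm w) * exp (- (a * norm w))"
        unfolding ng that using gr by (intro mult_right_mono) auto
      also have "\<dots> = C" by (simp add: exp_minus)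
      finally show ?thesis using M by simp
    qed
    have re1: "\<bar>Re \<omega>\<bar> = 1" if "Im \<omega> = 0" using \<omega> that by (simp add: cmod_eq_Re)
    have im1: "\<bar>Im \<omega>\<bar> = 1" if "Re \<omega> = 0" using \<omega> that by (simp add: cmod_eq_Im)
    have "norm (g w) \<le> M"
    proof (rule phragmen_lindelof_quadrant[where f = g and C = C and B = "2*a"])
      show "g holomorphic_on UNIV" unfolding g_def
        by (intro holomorphic_intros holomorphic_on_compose_gen[OF _ hol, unfolded o_def]) auto
      show "norm (g z) \<le> C * exp (2 * a * norm z)" for z
      proof -
        have "norm (g z) \<le> (C * exp (a * norm z)) * exp (a * norm z)"
          unfolding ng using gr imb C0 by (intro mult_mono) auto
        also have "\<dots> = C * exp (2 * a * norm z)" by (simp add: exp_add[symmetric])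
        finally show ?thesis .
      qed
      show "norm (g (of_real x)) \<le> M" if "x \<ge> 0" for x
      proof (cases "Im \<omega> = 0")
        case True then show ?thesis by (intro ax_real) simp
      next
        case False
        then have "Re \<omega> = 0" "b * Im \<omega> \<ge> 0" using axes by auto
        then have "b * Im \<omega> = a" using im1 bab by (metis abs_mult abs_of_nonneg mult.right_neutral)
        then show ?thesis using that by (intro ax_imag) (simp add: mult.assoc[symmetric])
      qed
      show "norm (g (\<i> * of_real y)) \<le> M" if "y \<ge> 0" for y
      proof (cases "Im \<omega> = 0")
        case True
        then have "b * Re \<omega> \<ge> 0" using axes re1 by auto
        then have "b * Re \<omega> = a" using re1 True bab by (metis abs_mult abs_of_nonneg mult.right_neutral)
        then show ?thesis using that by (intro ax_imag) (simp add: mult.assoc[symmetric] norm_mult)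
      next
        case False
        then show ?thesis using axes by (intro ax_real) simp
      qed
    qed (use M w in auto)
    then show ?thesis by (simp add: ng)
  qed
  have fin: ?thesis if "norm (f z) * exp (- (a * \<bar>Im z\<bar>)) \<le> M"
    using that by (simp add: exp_minus field_simps)
  consider "Re z \<ge> 0" "Im z \<ge> 0" | "Re z \<le> 0" "Im z \<ge> 0" | "Re z \<le> 0" "Im z \<le> 0" | "Re z \<ge> 0" "Im z \<le> 0"
    by linarith
  then show ?thesis
  proof cases
    case 1 then show ?thesis using main[of 1 a z] a by (intro fin) auto
  next
    case 2 then show ?thesis using main[of \<i> a "-\<i> * z"] a by (intro fin) (auto simp: mult.assoc[symmetric])
  next
    case 3 then show ?thesis using main[of "-1" "-a" "-z"] a by (intro fin) auto
  next
    case 4 then show ?thesis using main[of "-\<i>" "-a" "\<i> * z"] a by (intro fin) (auto simp: mult.assoc[symmetric])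
  qed
qed

section \<open>Paley-Wiener functions on horizontal lines\<close>

lemma integral_interval_norm_le_L2:
  fixes f :: "real \<Rightarrow> complex"
  assumes cont: "continuous_on UNIV f" and L2: "integrable lborel (\<lambda>x. (norm (f x))\<^sup>2)"
    and h: "0 \<le> h" "h \<le> 1"
  shows "integral {x..x+h} (\<lambda>t. norm (f t)) \<le> 1 + (LINT x|lborel. (norm (f x))\<^sup>2)"
proof -
  have c: "continuous_on A (\<lambda>t. norm (f t))" for A
    by (intro continuous_on_norm continuous_on_subset[OF cont]) auto
  have si: "set_integrable lborel {x..x+h} (\<lambda>t. norm (f t))"
    by (intro borel_integrable_atLeastAtMost') (rule c)
  have "integral {x..x+h} (\<lambda>t. norm (f t)) = (LINT t:{x..x+h}|lborel. norm (f t))"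
    using set_borel_integral_eq_integral(2)[OF si] by simp
  also have "\<dots> \<le> (LINT t|lborel. indicator {x..x+h} t + (norm (f t))\<^sup>2)"
    unfolding set_lebesgue_integral_def
  proof (rule integral_mono)
    show "integrable lborel (\<lambda>t. indicator {x..x+h} t *\<^sub>R norm (f t))"
      using si by (simp add: set_integrable_def)
    show "integrable lborel (\<lambda>t. indicator {x..x+h} t + (norm (f t))\<^sup>2)"
      by (intro Bochner_Integration.integrable_add L2 integrable_real_indicator) (auto simp: h)
    fix t
    have "2 * norm (f t) \<le> 1 + (norm (f t))\<^sup>2" using sum_squares_bound[of 1 "norm (f t)"] by simp
    then have "norm (f t) \<le> 1 + (norm (f t))\<^sup>2" using norm_ge_zero[of "f t"] by linarith
    then show "indicator {x..x+h} t *\<^sub>R norm (f t) \<le> indicator {x..x+h} t + (norm (f t))\<^sup>2"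
      by (auto simp: indicator_def)
  qed
  also have "\<dots> = h + (LINT x|lborel. (norm (f x))\<^sup>2)"
    using h by (subst Bochner_Integration.integral_add) (auto intro: L2)
  finally show ?thesis using h by simp
qed

text \<open>
Square integrability has to be turned into boundedness on the real line before the Phragmen-Lindeloef
bound can be applied to \<open>F\<close>. The differences \<open>P (z + h) - P z\<close> of a primitive are bounded on the real line
because they are integrals of \<open>F\<close> over short intervals; by Phragmen-Lindeloef they are bounded on strips, so by
the Cauchy inequality their derivatives \<open>F (x + h) - F x\<close> are bounded uniformly in \<open>h\<close>. Averaging over
\<open>h \<in> [0, 1]\<close> bounds \<open>F x\<close> itself.
\<close>

lemma exponential_type_L2_bound:
  fixes F :: "complex \<Rightarrow> complex"
  assumes hol: "F holomorphic_on UNIV"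
    and growth: "\<And>z. norm (F z) \<le> C * exp (a * norm z)" and a: "a \<ge> 0"
    and L2: "integrable lborel (\<lambda>x::real. (norm (F (of_real x)))\<^sup>2)"
  obtains M where "M > 0" "\<And>z. norm (F z) \<le> M * exp (a * \<bar>Im z\<bar>)"
proof -
  define N where "N = (LINT x|lborel. (norm (F (of_real x)))\<^sup>2)"
  have N0: "N \<ge> 0" unfolding N_def by (rule Bochner_Integration.integral_nonneg) simp
  have C0: "C \<ge> 0" using growth[of 0] norm_ge_zero[of "F 0"] by simp (meson order_trans norm_ge_zero)
  have cont: "continuous_on A F" for A
    using hol continuous_on_subset holomorphic_on_imp_continuous_on by blast
  have contR: "continuous_on A (\<lambda>x::real. F (of_real x))" for A
    by (intro continuous_on_compose2[OF cont[of UNIV]] continuous_intros) auto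
  obtain P where P: "\<And>z. (P has_field_derivative F z) (at z)"
    using holomorphic_convex_primitive'[OF convex_UNIV open_UNIV hol] by auto
  have holP: "P holomorphic_on A" for A
    using P by (meson field_differentiable_def field_differentiable_at_within holomorphic_onI)
  have mean: "integral {x..x+h} (\<lambda>t. norm (F (of_real t))) \<le> 1 + N" if "0 \<le> h" "h \<le> 1" for x h
    unfolding N_def by (intro integral_interval_norm_le_L2 contR L2 that)
  define M0 where "M0 = max (C * exp a) (1 + N)"
  have M0: "M0 > 0" "C * exp a \<le> M0" "1 + N \<le> M0" using N0 by (auto simp: M0_def)
  have diff: "norm (F (of_real (x + h)) - F (of_real x)) \<le> M0 * exp a" if h: "0 \<le> h" "h \<le> 1" for x h :: real
  proof -
    define H where "H = (\<lambda>z. P (z + of_real h) - P z)"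
    have holH: "H holomorphic_on A" for A
      unfolding H_def
      by (intro holomorphic_intros holP holomorphic_on_compose_gen[OF _ holP[of UNIV], unfolded o_def]) auto
    have growthH: "norm (H z) \<le> (C * exp a) * exp (a * norm z)" for z
    proof -
      have "norm (P (z + of_real h) - P z) \<le> (C * exp (a * (norm z + 1))) * norm ((z + of_real h) - z)"
      proof (rule field_differentiable_bound[of "cball z 1"])
        fix w assume "w \<in> cball z 1"
        then have "norm w \<le> norm z + 1" by (simp add: dist_norm) (smt (verit) norm_triangle_sub norm_minus_commute)
        then have "C * exp (a * norm w) \<le> C * exp (a * (norm z + 1))"
          using C0 a by (intro mult_left_mono) (auto intro: mult_left_mono)
        then show "norm (F w) \<le> C * exp (a * (norm z + 1))" using growth[of w] by linarith
        show "(P has_field_derivative F w) (at w within cball z 1)"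
          using P by (rule has_field_derivative_at_within)
      qed (use h in \<open>auto simp: dist_norm\<close>)
      also have "\<dots> \<le> (C * exp (a * (norm z + 1))) * 1"
        using h C0 by (intro mult_left_mono) auto
      also have "\<dots> = (C * exp a) * exp (a * norm z)" by (simp add: exp_add algebra_simps)
      finally show ?thesis by (simp add: H_def)
    qed
    have realH: "norm (H (of_real x)) \<le> M0" for x
    proof -
      have "((\<lambda>t. F (of_real t)) has_integral (P (of_real (x + h)) - P (of_real x))) {x..x+h}"
      proof (rule fundamental_theorem_of_calculus)
        fix t assume "t \<in> {x..x+h}"
        have "((\<lambda>t. P (of_real t)) has_vector_derivative F (of_real t)) (at t)"
          using P by (rule has_vector_derivative_real_field)
        then show "((\<lambda>t. P (of_real t)) has_vector_derivative F (of_real t)) (at t within {x..x+h})"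
          by (rule has_vector_derivative_at_within)
      qed (use h in simp)
      then have "H (of_real x) = integral {x..x+h} (\<lambda>t. F (of_real t))"
        by (simp add: H_def integral_unique)
      also have "norm \<dots> \<le> integral {x..x+h} (\<lambda>t. norm (F (of_real t)))"
        by (intro integral_norm_bound_integral integrable_continuous_interval continuous_on_norm contR) auto
      also have "\<dots> \<le> M0" using mean[OF h] M0(3) by (rule order_trans)
      finally show ?thesis .
    qed
    have H: "norm (H z) \<le> M0 * exp (a * \<bar>Im z\<bar>)" for z
      by (rule phragmen_lindelof_exponential_type[OF holH growthH a M0(1,2) realH])
    have "norm ((deriv ^^ 1) H (of_real x)) \<le> fact 1 * (M0 * exp a) / 1 ^ 1"
    proof (rule Cauchy_inequality)
      fix w :: complex assume "norm (of_real x - w) = 1"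
      then have "\<bar>Im w\<bar> \<le> 1" using abs_Im_le_cmod[of "of_real x - w"] by simp
      then have "M0 * exp (a * \<bar>Im w\<bar>) \<le> M0 * exp a"
        using M0 a by (simp add: mult_left_le)
      then show "norm (H w) \<le> M0 * exp a" using H[of w] by linarith
    qed (use holH holomorphic_on_imp_continuous_on[OF holH] in auto)
    moreover have "deriv H (of_real x) = F (of_real x + of_real h) - F (of_real x)"
      unfolding H_def
      by (rule DERIV_imp_deriv) (intro DERIV_diff DERIV_shift[THEN iffD1] P)
    ultimately show ?thesis by simp
  qed
  define B where "B = M0 * exp a + 1 + N"
  have bR: "norm (F (of_real x)) \<le> B" for x
  proof -
    have "integral {x..x+1} (\<lambda>t. norm (F (of_real x))) \<le> integral {x..x+1} (\<lambda>t. M0 * exp a + norm (F (of_real t)))"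
    proof (rule integral_le)
      fix t assume "t \<in> {x..x+1}"
      then have "norm (F (of_real (x + (t - x))) - F (of_real x)) \<le> M0 * exp a" by (intro diff) auto
      then show "norm (F (of_real x)) \<le> M0 * exp a + norm (F (of_real t))"
        by simp (smt (verit) norm_triangle_sub norm_minus_commute)
    qed (auto intro!: integrable_continuous_interval continuous_intros contR)
    also have "\<dots> = M0 * exp a + integral {x..x+1} (\<lambda>t. norm (F (of_real t)))"
      by (subst integral_add) (auto intro!: integrable_continuous_interval continuous_intros contR)
    also have "\<dots> \<le> B" using mean[of 1 x] by (simp add: B_def)
    finally show ?thesis by simp
  qed
  have "norm (F z) \<le> max C B * exp (a * \<bar>Im z\<bar>)" for z
    using M0 N0 bR by (intro phragmen_lindelof_exponential_type[OF hol growth a]) (auto simp: B_def less_max_iff_disj le_max_iff_disj add_pos_nonneg)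
  moreover have "max C B > 0" using M0 N0 by (auto simp: B_def less_max_iff_disj add_pos_nonneg)
  ultimately show ?thesis using that by blast
qed

lemma PW_bound:
  assumes F: "F \<in> PW" and a: "a > pi"
  obtains M where "M > 0" "\<And>z. norm (F z) \<le> M * exp (a * \<bar>Im z\<bar>)"
proof -
  have "a - pi > 0" using a by simp
  then obtain C where "\<And>z. norm (F z) \<le> C * exp ((pi + (a - pi)) * norm z)"
    using F unfolding PW_def by blast
  moreover have "a \<ge> 0" using a pi_gt_zero by linarith
  ultimately obtain M where "M > 0" "\<And>z. norm (F z) \<le> M * exp (a * \<bar>Im z\<bar>)"
    using F exponential_type_L2_bound[of F C a] unfolding PW_def by auto
  then show ?thesis by (rule that)
qed

section \<open>De la Vallee Poussin kernels\<close>

text \<open>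
Up to a constant factor, the difference of two Fejer kernels, known as a de la Vallee Poussin kernel. For
\<open>0 < a < b\<close> its Fourier transform is a trapezoid which is constant on \<open>[-a, a]\<close> and vanishes outside
\<open>[-b, b]\<close>. The value 0 at the origin, which comes from division by 0, affects no integral.
\<close>

definition vp_kernel :: "real \<Rightarrow> real \<Rightarrow> real \<Rightarrow> real" where
  "vp_kernel a b x = (cos (a * x) - cos (b * x)) / x\<^sup>2"

lemma integrable_inverse_one_plus_square: "integrable lborel (\<lambda>x::real. K / (1 + x\<^sup>2))"
proof -
  have "einterval (-\<infinity>) \<infinity> = UNIV" by (auto simp: einterval_def)
  then have "integrable lborel (\<lambda>x::real. inverse (1 + x\<^sup>2))"
    using integrable_inverse_1_plus_square by (simp add: set_integrable_def)
  then show ?thesis using integrable_mult_right[of K lborel "\<lambda>x. inverse (1 + x\<^sup>2)"]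
    by (simp add: divide_inverse)
qed

lemma abs_cos_diff_le: "\<bar>cos (a * x) - cos (b * x)\<bar> \<le> \<bar>b\<^sup>2 - a\<^sup>2\<bar> / 2 * x\<^sup>2" for x :: real
proof -
  have "\<bar>cos (a * x) - cos (b * x)\<bar> = 2 * \<bar>sin ((a * x + b * x) / 2)\<bar> * \<bar>sin ((b * x - a * x) / 2)\<bar>"
    by (simp add: cos_diff_cos abs_mult)
  also have "\<dots> \<le> 2 * \<bar>(a * x + b * x) / 2\<bar> * \<bar>(b * x - a * x) / 2\<bar>"
    by (intro mult_mono abs_sin_x_le_abs_x) auto
  also have "\<dots> = \<bar>2 * ((a * x + b * x) / 2) * ((b * x - a * x) / 2)\<bar>" by (simp only: abs_mult abs_numeral)
  also have "2 * ((a * x + b * x) / 2) * ((b * x - a * x) / 2) = (b\<^sup>2 - a\<^sup>2) / 2 * x\<^sup>2"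
    by (simp add: power2_eq_square field_simps)
  finally show ?thesis by (simp add: abs_mult)
qed

lemma vp_kernel_bound: "\<bar>vp_kernel a b x\<bar> \<le> (\<bar>b\<^sup>2 - a\<^sup>2\<bar> / 2 + 2) / (1 + x\<^sup>2)"
proof (cases "x = 0")
  case False
  have "\<bar>cos (a * x) - cos (b * x)\<bar> * (1 + x\<^sup>2) \<le> \<bar>b\<^sup>2 - a\<^sup>2\<bar> / 2 * x\<^sup>2 + 2 * x\<^sup>2"
  proof -
    have "\<bar>cos (a * x) - cos (b * x)\<bar> \<le> 2"
      using abs_cos_le_one[of "a * x"] abs_cos_le_one[of "b * x"] by linarith
    then have "\<bar>cos (a * x) - cos (b * x)\<bar> * x\<^sup>2 \<le> 2 * x\<^sup>2" by (intro mult_right_mono) auto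
    then show ?thesis using abs_cos_diff_le[of a x b] by (simp add: algebra_simps)
  qed
  moreover have "1 + x\<^sup>2 > 0" by (simp add: add_pos_nonneg)
  ultimately show ?thesis using False by (simp add: vp_kernel_def abs_div divide_simps) (simp add: algebra_simps)
qed (simp add: vp_kernel_def add_nonneg_nonneg)

lemma vp_kernel_measurable [measurable]: "vp_kernel a b \<in> borel_measurable borel"
  unfolding vp_kernel_def by measurable

lemma integrable_bounded_times_vp_kernel:
  fixes f :: "real \<Rightarrow> complex"
  assumes [measurable]: "f \<in> borel_measurable borel" and bound: "\<And>x. norm (f x) \<le> M"
  shows "integrable lborel (\<lambda>x. f x * of_real (vp_kernel a b x))"
proof (rule Bochner_Integration.integrable_bound[OF integrable_inverse_one_plus_square])
  show "AE x in lborel. norm (f x * of_real (vp_kernel a b x)) \<le> norm (M * (\<bar>b\<^sup>2 - a\<^sup>2\<bar> / 2 + 2) / (1 + x\<^sup>2))"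
  proof (intro AE_I2)
    fix x
    have M: "M \<ge> 0" using bound[of 0] norm_ge_zero order_trans by blast
    have "norm (f x * of_real (vp_kernel a b x)) \<le> M * ((\<bar>b\<^sup>2 - a\<^sup>2\<bar> / 2 + 2) / (1 + x\<^sup>2))"
      unfolding norm_mult using bound vp_kernel_bound M by (intro mult_mono) auto
    then show "norm (f x * of_real (vp_kernel a b x)) \<le> norm (M * (\<bar>b\<^sup>2 - a\<^sup>2\<bar> / 2 + 2) / (1 + x\<^sup>2))"
      unfolding real_norm_def by (intro order_trans[OF _ abs_ge_self]) simp
  qed
qed measurable

lemma integral_symmetric_interval_tendsto:
  fixes f :: "real \<Rightarrow> complex"
  assumes f: "integrable lborel f"
  shows "(\<lambda>n. integral {-real n..real n} f) \<longlonglongrightarrow> (LINT x|lborel. f x)"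
proof -
  have si: "set_integrable lborel {-real n..real n} f" for n
    using f by (simp add: integrable_mult_indicator set_integrable_def)
  have "(\<lambda>n. LINT x|lborel. indicator {-real n..real n} x *\<^sub>R f x) \<longlonglongrightarrow> (LINT x|lborel. f x)"
  proof (rule integral_dominated_convergence[where w = "\<lambda>x. norm (f x)"])
    show "AE x in lborel. (\<lambda>n. indicator {-real n..real n} x *\<^sub>R f x) \<longlonglongrightarrow> f x"
    proof (intro AE_I2 tendsto_eventually)
      fix x
      obtain N where N: "\<bar>x\<bar> \<le> real N" using real_arch_simple by blast
      show "\<forall>\<^sub>F n in sequentially. indicator {-real n..real n} x *\<^sub>R f x = f x"
        using eventually_ge_at_top[of N] by eventually_elim (use N in \<open>auto simp: indicator_def\<close>)
    qed
  qed (use f in \<open>auto simp: indicator_def\<close>)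
  moreover have "(LINT x|lborel. indicator {-real n..real n} x *\<^sub>R f x) = integral {-real n..real n} f" for n
    using set_borel_integral_eq_integral(2)[OF si[of n]] by (simp add: set_lebesgue_integral_def)
  ultimately show ?thesis by simp
qed

lemma sin_nonpos_on_pi_2pi: "pi \<le> x \<Longrightarrow> x \<le> 2 * pi \<Longrightarrow> sin x \<le> 0"
  using sin_ge_zero[of "x - pi"] by simp

text \<open>
The residue computation behind the reproducing property. Write twice the kernel as \<open>(E z - E (-z)) / z\<close> with the
entire function $E(z) = (e^{iaz} - e^{ibz})/z$. The part with \<open>E z\<close> is $O(R^{-2})$ on the upper half
circle of radius \<open>R\<close>, the part with \<open>E (-z)\<close> on the lower one, because \<open>a\<close> and \<open>b\<close> dominate the exponential type
of \<open>F\<close>. Closing both parts in the upper half plane and moving the second one to the lower half circle picks up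
the residue at 0, which is the term with \<open>F 0\<close>.
\<close>

lemma vp_kernel_contour_estimate:
  fixes F :: "complex \<Rightarrow> complex"
  assumes hol: "F holomorphic_on UNIV"
    and bound: "\<And>z. norm (F z) \<le> M * exp (c * \<bar>Im z\<bar>)"
    and ab: "c \<le> a" "c \<le> b" and R: "R > 0"
  shows "norm (integral {-R..R} (\<lambda>x. F (of_real x) * of_real (2 * vp_kernel a b x))
               - 2 * of_real (pi * (b - a)) * F 0) \<le> 4 * pi * M / R"
proof -
  define E where "E = (\<lambda>z. if z = 0 then \<i> * of_real (a - b) else (exp (\<i> * of_real a * z) - exp (\<i> * of_real b * z)) / z)"
  define V where "V = (\<lambda>z. if z = 0 then 2 * deriv E 0 else (E z - E (-z)) / z)"
  have M: "M \<ge> 0" using bound[of 0] norm_ge_zero[of "F 0"] by simp (meson order_trans norm_ge_zero)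
  have holE: "E holomorphic_on UNIV"
  proof (rule pole_theorem_open_0[where a = 0 and g = "\<lambda>z. exp (\<i> * of_real a * z) - exp (\<i> * of_real b * z)"])
    have "((\<lambda>z. exp (\<i> * of_real a * z) - exp (\<i> * of_real b * z)) has_field_derivative \<i> * of_real (a - b)) (at 0)"
      by (auto intro!: derivative_eq_intros simp: algebra_simps)
    then show "E 0 = deriv (\<lambda>z. exp (\<i> * of_real a * z) - exp (\<i> * of_real b * z)) 0"
      by (simp add: E_def DERIV_imp_deriv)
  qed (auto intro!: holomorphic_intros simp: E_def)
  have holE': "(\<lambda>z. E (-z)) holomorphic_on A" for A
    by (intro holomorphic_on_compose_gen[OF _ holE, unfolded o_def] holomorphic_intros) auto
  have holV: "V holomorphic_on UNIV"
  proof (rule pole_theorem_open_0[where a = 0 and g = "\<lambda>z. E z - E (-z)"])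
    have dE: "(E has_field_derivative deriv E 0) (at 0)"
      using holE by (meson UNIV_I holomorphic_derivI open_UNIV)
    have "((\<lambda>z. E (-z)) has_field_derivative deriv E 0 * (-1)) (at 0)"
      by (rule DERIV_chain2[where f = E]) (use dE in \<open>auto intro!: derivative_eq_intros\<close>)
    then have "((\<lambda>z. E z - E (-z)) has_field_derivative 2 * deriv E 0) (at 0)"
      using DERIV_diff[OF dE] by fastforce
    then show "V 0 = deriv (\<lambda>z. E z - E (-z)) 0" by (simp add: V_def DERIV_imp_deriv)
  qed (use holE holE' in \<open>auto intro!: holomorphic_intros simp: V_def\<close>)
  define g where "g = (\<lambda>z. F z * E z / z)"
  define h where "h = (\<lambda>z. F z * (- E (-z)) / (z - 0))"
  define U where "U = part_circlepath 0 R 0 pi"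
  define L where "L = part_circlepath 0 R pi (2*pi)"
  have cont: "continuous_on A F" "continuous_on A E" "continuous_on A (\<lambda>z. E (-z))" for A
    using hol holE holE' by (meson holomorphic_on_imp_continuous_on holomorphic_on_subset subset_UNIV)+
  have pU: "norm z = R \<and> Im z \<ge> 0" if "z \<in> path_image U" for z
    using that R by (auto simp: U_def path_image_part_circlepath norm_mult Im_exp sin_ge_zero)
  have pL: "norm z = R \<and> Im z \<le> 0" if "z \<in> path_image L" for z
    using that R by (auto simp: L_def path_image_part_circlepath norm_mult Im_exp intro!: mult_nonneg_nonpos sin_nonpos_on_pi_2pi)
  have nz: "z \<noteq> 0" if "z \<in> path_image U \<or> z \<in> path_image L" for z
    using that pU[of 0] pL[of 0] R by auto
  have cg: "continuous_on (path_image U) g"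
    unfolding g_def using nz by (intro continuous_intros cont) auto
  have chU: "continuous_on (path_image U) h" and chL: "continuous_on (path_image L) h"
    unfolding h_def using nz by (auto intro!: continuous_intros cont)
  have gU: "g contour_integrable_on U" and hU: "h contour_integrable_on U" and hL: "h contour_integrable_on L"
    using cg chU chL unfolding U_def L_def by (auto intro: contour_integrable_continuous_part_circlepath)
  have upper: "norm (exp (\<i> * of_real b * z)) \<le> exp (- (c * Im z))" if "Im z \<ge> 0" "c \<le> b" for b z
    using that unfolding norm_exp_i_mult by (simp add: mult_right_mono)
  \<comment> \<open>A single bound serves both half circles: \<open>w\<close> is the argument of \<open>F\<close>, while \<open>z\<close>, which is \<open>w\<close> or \<open>-w\<close>, lies in
    the upper half plane.\<close>
  have bE: "norm (F w * E z / z') \<le> 2 * M / R\<^sup>2"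
    if "Im z \<ge> 0" "norm z = R" "norm z' = R" "\<bar>Im w\<bar> = Im z" for z z' w
  proof -
    have "norm (exp (\<i> * of_real a * z) - exp (\<i> * of_real b * z)) \<le> exp (- (c * Im z)) + exp (- (c * Im z))"
      using upper[OF that(1) ab(1)] upper[OF that(1) ab(2)] by (intro order_trans[OF norm_triangle_ineq4] add_mono)
    moreover have "norm (F w) \<le> M * exp (c * Im z)" using bound[of w] that by simp
    ultimately have "norm (F w) * norm (exp (\<i> * of_real a * z) - exp (\<i> * of_real b * z))
         \<le> (M * exp (c * Im z)) * (2 * exp (- (c * Im z)))"
      using M by (intro mult_mono) auto
    also have "\<dots> = 2 * M" by (simp add: exp_minus)
    finally have "norm (F w) * norm (exp (\<i> * of_real a * z) - exp (\<i> * of_real b * z)) / R\<^sup>2 \<le> 2 * M / R\<^sup>2"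
      by (rule divide_right_mono) simp
    moreover have "norm (F w * E z / z') = norm (F w) * norm (exp (\<i> * of_real a * z) - exp (\<i> * of_real b * z)) / R\<^sup>2"
      using that R by (auto simp: E_def norm_mult norm_divide power2_eq_square)
    ultimately show ?thesis by simp
  qed
  have IU: "norm (contour_integral U g) \<le> 2 * M / R\<^sup>2 * R * \<bar>pi - 0\<bar>"
    unfolding U_def
  proof (rule contour_integral_bound_part_circlepath)
    fix z assume "z \<in> path_image (part_circlepath 0 R 0 pi)"
    then show "norm (g z) \<le> 2 * M / R\<^sup>2" using pU[of z] bE[of z z z] unfolding g_def U_def by auto
  qed (use gU M R in \<open>auto simp: U_def\<close>)
  have IL: "norm (contour_integral L h) \<le> 2 * M / R\<^sup>2 * R * \<bar>2 * pi - pi\<bar>"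
    unfolding L_def
  proof (rule contour_integral_bound_part_circlepath)
    fix z assume "z \<in> path_image (part_circlepath 0 R pi (2 * pi))"
    then show "norm (h z) \<le> 2 * M / R\<^sup>2" using pL[of z] bE[of "-z" z z] unfolding h_def L_def by auto
  qed (use hL M R in \<open>auto simp: L_def\<close>)
  have "contour_integral U h + contour_integral L h = contour_integral (circlepath 0 R) h"
  proof -
    have "(h has_contour_integral 2 * of_real pi * \<i> * (F 0 * (- E (- 0)))) (circlepath 0 R)"
      unfolding h_def
      using R by (intro Cauchy_integral_circlepath)
                 (auto intro!: continuous_intros holomorphic_intros cont holE' holomorphic_on_subset[OF hol])
    then have "h contour_integrable_on part_circlepath 0 R 0 (2 * pi)"
      by (auto simp: circlepath_def contour_integrable_on_def)
    then have "(\<lambda>t. h (0 + of_real R * cis t) * of_real R * \<i> * cis t) integrable_on {0..2*pi}"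
      by (subst (asm) contour_integrable_part_circlepath_iff) auto
    then show ?thesis unfolding U_def L_def circlepath_def
      by (simp add: contour_integral_part_circlepath_eq Henstock_Kurzweil_Integration.integral_combine)
  qed
  also have "\<dots> = 2 * of_real pi * \<i> * (F 0 * (- E (- 0)))"
    unfolding h_def
    using R by (intro contour_integral_unique Cauchy_integral_circlepath)
               (auto intro!: continuous_intros holomorphic_intros cont holE' holomorphic_on_subset[OF hol])
  also have "\<dots> = - (2 * of_real (pi * (b - a)) * F 0)" by (simp add: E_def algebra_simps)
  finally have res: "contour_integral U h = - (2 * of_real (pi * (b - a)) * F 0) - contour_integral L h"
    by (simp add: algebra_simps)
  have closed: "((\<lambda>z. F z * V z) has_contour_integral 0) (linepath (of_real (-R)) (of_real R) +++ U)"
    using hol holV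
    by (intro Cauchy_theorem_convex_simple[of _ UNIV] holomorphic_intros valid_path_join)
       (auto simp: U_def)
  have FV: "(\<lambda>z. F z * V z) contour_integrable_on linepath (of_real (-R)) (of_real R)"
       "(\<lambda>z. F z * V z) contour_integrable_on U"
    using hol holV
    by (auto intro!: contour_integrable_holomorphic_simple[of _ UNIV] holomorphic_intros simp: U_def)
  have "contour_integral (linepath (of_real (-R)) (of_real R)) (\<lambda>z. F z * V z) + contour_integral U (\<lambda>z. F z * V z) = 0"
    using contour_integral_unique[OF closed] FV by (subst (asm) contour_integral_join) (auto simp: U_def)
  moreover have "contour_integral U (\<lambda>z. F z * V z) = contour_integral U (\<lambda>z. g z + h z)"
    using nz by (intro contour_integral_eq) (auto simp: V_def g_def h_def diff_divide_distrib algebra_simps)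
  moreover have "contour_integral U (\<lambda>z. g z + h z) = contour_integral U g + contour_integral U h"
    by (rule contour_integral_add[OF gU hU])
  ultimately have "contour_integral (linepath (of_real (-R)) (of_real R)) (\<lambda>z. F z * V z)
      - 2 * of_real (pi * (b - a)) * F 0 = contour_integral L h - contour_integral U g"
    using res by (simp add: algebra_simps add_eq_0_iff)
  moreover have "contour_integral (linepath (of_real (-R)) (of_real R)) (\<lambda>z. F z * V z) = integral {-R..R} (\<lambda>x. F (of_real x) * V (of_real x))"
    using R by (subst contour_integral_linepath_Reals_eq) auto
  moreover have "integral {-R..R} (\<lambda>x. F (of_real x) * V (of_real x)) = integral {-R..R} (\<lambda>x. F (of_real x) * of_real (2 * vp_kernel a b x))"
  proof (rule integral_spike[of "{0}"])
    fix x assume "x \<in> {-R..R} - {0}"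
    then have x: "x \<noteq> 0" by simp
    have "cis (- t) = of_real (2 * cos t) - cis t" for t by (simp add: complex_eq_iff)
    then have "V (of_real x) = of_real (2 * vp_kernel a b x)"
      using x by (simp add: V_def E_def vp_kernel_def exp_eq_polar flip: cis_conv_exp)
        (simp add: power2_eq_square divide_simps)
    then show "F (of_real x) * of_real (2 * vp_kernel a b x) = F (of_real x) * V (of_real x)" by simp
  qed auto
  ultimately have "norm (integral {-R..R} (\<lambda>x. F (of_real x) * of_real (2 * vp_kernel a b x))
               - 2 * of_real (pi * (b - a)) * F 0) = norm (contour_integral L h - contour_integral U g)"
    by metis
  also have "\<dots> \<le> 2 * M / R\<^sup>2 * R * \<bar>2 * pi - pi\<bar> + 2 * M / R\<^sup>2 * R * \<bar>pi - 0\<bar>"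
    by (intro order_trans[OF norm_triangle_ineq4] add_mono IU IL)
  also have "\<dots> = 4 * pi * M / R" using R by (simp add: power2_eq_square field_simps)
  finally show ?thesis .
qed

lemma entire_restriction_measurable:
  assumes hol: "F holomorphic_on UNIV"
  shows "(\<lambda>x::real. F (of_real x)) \<in> borel_measurable borel"
  by (intro borel_measurable_continuous_onI
        continuous_on_compose2[OF holomorphic_on_imp_continuous_on[OF hol]] continuous_intros) auto

text \<open>
This formula is used three times: with \<open>a\<close> and \<open>b\<close> decreasing to \<open>pi\<close> it yields the reproducing formula, for the
difference of two kernels with equal \<open>b - a\<close> it shows that functions in \<^const>\<open>PW\<close> are orthogonal to frequencies above
\<open>pi\<close>, and for \<open>F = 1\<close> it computes Fourier transforms.
\<close>

lemma integral_times_vp_kernel: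
  fixes F :: "complex \<Rightarrow> complex"
  assumes hol: "F holomorphic_on UNIV"
    and bound: "\<And>z. norm (F z) \<le> M * exp (c * \<bar>Im z\<bar>)"
    and ab: "c \<le> a" "c \<le> b"
  shows "integrable lborel (\<lambda>x. F (of_real x) * of_real (vp_kernel a b x))"
    and "(LINT x|lborel. F (of_real x) * of_real (vp_kernel a b x)) = of_real (pi * (b - a)) * F 0"
proof -
  have meas: "(\<lambda>x::real. F (of_real x)) \<in> borel_measurable borel"
    by (rule entire_restriction_measurable[OF hol])
  have bR: "norm (F (of_real x)) \<le> M" for x using bound[of "of_real x"] by simp
  show int: "integrable lborel (\<lambda>x. F (of_real x) * of_real (vp_kernel a b x))"
    by (rule integrable_bounded_times_vp_kernel[OF meas bR])
  define I where "I = (LINT x|lborel. F (of_real x) * of_real (vp_kernel a b x))"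
  have "integrable lborel (\<lambda>x. F (of_real x) * of_real (2 * vp_kernel a b x))"
    using integrable_mult_right[OF int, of 2] by (simp add: mult_ac)
  from integral_symmetric_interval_tendsto[OF this]
  have lim: "(\<lambda>n. integral {-real n..real n} (\<lambda>x. F (of_real x) * of_real (2 * vp_kernel a b x))) \<longlonglongrightarrow> 2 * I"
    using integral_mult_right_zero[of lborel 2 "\<lambda>x. F (of_real x) * of_real (vp_kernel a b x)"]
    unfolding I_def by (simp add: mult_ac)
  have "(\<lambda>n. integral {-real n..real n} (\<lambda>x. F (of_real x) * of_real (2 * vp_kernel a b x))
          - 2 * of_real (pi * (b - a)) * F 0) \<longlonglongrightarrow> 0"
  proof (rule Lim_null_comparison)
    show "\<forall>\<^sub>F n in sequentially. norm (integral {-real n..real n} (\<lambda>x. F (of_real x) * of_real (2 * vp_kernel a b x))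
          - 2 * of_real (pi * (b - a)) * F 0) \<le> 4 * pi * M / real n"
      using eventually_gt_at_top[of 0]
      by eventually_elim (rule vp_kernel_contour_estimate[OF hol bound ab], simp)
    show "(\<lambda>n. 4 * pi * M / real n) \<longlonglongrightarrow> 0" by real_asymp
  qed
  then have "(\<lambda>n. integral {-real n..real n} (\<lambda>x. F (of_real x) * of_real (2 * vp_kernel a b x)))
      \<longlonglongrightarrow> 2 * of_real (pi * (b - a)) * F 0" by (simp add: LIM_zero_iff)
  from LIMSEQ_unique[OF lim this] show "I = of_real (pi * (b - a)) * F 0" by simp
qed

section \<open>The reproducing formula\<close>

lemma integrable_of_norm_le:
  fixes f :: "'a \<Rightarrow> 'b::{banach, second_countable_topology}" and g :: "'a \<Rightarrow> real"
  assumes "integrable N g" "f \<in> borel_measurable N" "\<And>x. norm (f x) \<le> g x"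
  shows "integrable N f"
proof (rule Bochner_Integration.integrable_bound[OF assms(1,2)])
  show "AE x in N. norm (f x) \<le> norm (g x)"
  proof (rule AE_I2)
    fix x show "norm (f x) \<le> norm (g x)" using assms(3)[of x] by simp
  qed
qed

lemma mult_le_sum_squares: "x * y \<le> x\<^sup>2 + y\<^sup>2" if "x \<ge> 0" "y \<ge> 0" for x y :: real
proof -
  have "2 * (x * y) \<le> x\<^sup>2 + y\<^sup>2" using sum_squares_bound[of x y] by simp
  moreover have "x * y \<ge> 0" using that by simp
  ultimately show ?thesis by linarith
qed

lemma integrable_L2_product:
  fixes f g :: "'a \<Rightarrow> complex"
  assumes [measurable]: "f \<in> borel_measurable N" "g \<in> borel_measurable N"
    and f: "integrable N (\<lambda>x. (norm (f x))\<^sup>2)" and g: "integrable N (\<lambda>x. (norm (g x))\<^sup>2)"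
  shows "integrable N (\<lambda>x. f x * g x)"
    and "(LINT x|N. norm (f x * g x)) \<le> (LINT x|N. (norm (f x))\<^sup>2) + (LINT x|N. (norm (g x))\<^sup>2)"
proof -
  have *: "norm (f x * g x) \<le> (norm (f x))\<^sup>2 + (norm (g x))\<^sup>2" for x
    unfolding norm_mult by (intro mult_le_sum_squares) auto
  show int: "integrable N (\<lambda>x. f x * g x)"
    by (rule integrable_of_norm_le[OF Bochner_Integration.integrable_add[OF f g] _ *]) measurable
  have "(LINT x|N. norm (f x * g x)) \<le> (LINT x|N. (norm (f x))\<^sup>2 + (norm (g x))\<^sup>2)"
    by (intro integral_mono integrable_norm int Bochner_Integration.integrable_add f g *)
  also have "\<dots> = (LINT x|N. (norm (f x))\<^sup>2) + (LINT x|N. (norm (g x))\<^sup>2)"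
    by (rule Bochner_Integration.integral_add[OF f g])
  finally show "(LINT x|N. norm (f x * g x)) \<le> (LINT x|N. (norm (f x))\<^sup>2) + (LINT x|N. (norm (g x))\<^sup>2)" .
qed

lemma nsinc_holomorphic: "nsinc holomorphic_on UNIV"
proof (rule pole_theorem_open_0[where a = 0 and g = "\<lambda>z. sin (of_real pi * z) / of_real pi"])
  have "((\<lambda>z::complex. sin (of_real pi * z) / of_real pi) has_field_derivative 1) (at 0)"
    by (auto intro!: derivative_eq_intros)
  then show "nsinc 0 = deriv (\<lambda>z. sin (of_real pi * z) / of_real pi) 0"
    by (simp add: nsinc_def DERIV_imp_deriv)
qed (auto intro!: holomorphic_intros simp: nsinc_def)

lemma nsinc_measurable [measurable]: "nsinc \<in> borel_measurable borel"
  using nsinc_holomorphic by (intro borel_measurable_continuous_onI holomorphic_on_imp_continuous_on)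

lemma nsinc_of_real: "x \<noteq> 0 \<Longrightarrow> nsinc (of_real x) = of_real (sin (pi * x) / (pi * x))"
  using sin_of_real[of "pi * x", where 'a = complex] unfolding nsinc_def by simp

lemma nsinc_minus: "nsinc (- z) = nsinc z"
  by (simp add: nsinc_def)

lemma norm_nsinc_of_real_le_1: "norm (nsinc (of_real x)) \<le> 1"
proof (cases "x = 0")
  case False
  then have "\<bar>sin (pi * x)\<bar> / \<bar>pi * x\<bar> \<le> 1" using abs_sin_x_le_abs_x[of "pi * x"] by (simp add: divide_simps)
  then show ?thesis using False unfolding nsinc_of_real[OF False] norm_of_real by (simp add: abs_div)
qed (simp add: nsinc_def)

lemma norm_nsinc_of_real_square_le: "(norm (nsinc (of_real x)))\<^sup>2 \<le> 2 / (1 + x\<^sup>2)"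
proof -
  have 1: "(norm (nsinc (of_real x)))\<^sup>2 \<le> 1"
    using norm_nsinc_of_real_le_1[of x] by (simp add: power_le_one)
  have 2: "(norm (nsinc (of_real x)))\<^sup>2 * x\<^sup>2 \<le> 1"
  proof (cases "x = 0")
    case False
    have "\<bar>sin (pi * x)\<bar> \<le> pi"
      by (rule order_trans[OF abs_sin_le_one]) (use pi_ge_two in linarith)
    moreover have "norm (nsinc (of_real x)) * \<bar>x\<bar> = \<bar>sin (pi * x)\<bar> / pi"
      using False unfolding nsinc_of_real[OF False] norm_of_real by (simp add: abs_mult)
    ultimately have "norm (nsinc (of_real x)) * \<bar>x\<bar> \<le> 1" by simp
    then have "(norm (nsinc (of_real x)) * \<bar>x\<bar>)\<^sup>2 \<le> 1" by (simp add: power_le_one)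
    then show ?thesis by (simp add: power_mult_distrib)
  qed simp
  have "1 + x\<^sup>2 > 0" by (simp add: add_pos_nonneg)
  then show ?thesis using 1 2 by (simp add: pos_le_divide_eq algebra_simps)
qed

lemma nsinc_translate_L2:
  "integrable lborel (\<lambda>x. (norm (nsinc (of_real (t - x))))\<^sup>2)"
  "(LINT x|lborel. (norm (nsinc (of_real (t - x))))\<^sup>2) = (LINT x|lborel. (norm (nsinc (of_real x)))\<^sup>2)"
proof -
  have "integrable lborel (\<lambda>x. (norm (nsinc (of_real x)))\<^sup>2)"
  proof (rule integrable_of_norm_le[OF integrable_inverse_one_plus_square[of 2]])
    show "norm ((norm (nsinc (of_real x)))\<^sup>2) \<le> 2 / (1 + x\<^sup>2)" for x
      using norm_nsinc_of_real_square_le[of x] by simp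
  qed measurable
  then show "integrable lborel (\<lambda>x. (norm (nsinc (of_real (t - x))))\<^sup>2)"
    using lborel_integrable_real_affine_iff[of "-1" "\<lambda>x. (norm (nsinc (of_real x)))\<^sup>2" t] by simp
  show "(LINT x|lborel. (norm (nsinc (of_real (t - x))))\<^sup>2) = (LINT x|lborel. (norm (nsinc (of_real x)))\<^sup>2)"
    using lborel_integral_real_affine[of "-1" "\<lambda>x. (norm (nsinc (of_real x)))\<^sup>2" t] by simp
qed

lemma PW_restriction_measurable:
  "F \<in> PW \<Longrightarrow> (\<lambda>x::real. F (of_real x)) \<in> borel_measurable borel"
  by (intro entire_restriction_measurable) (simp add: PW_def)

text \<open>
A square integrable majorant that does not depend on \<open>\<delta>\<close>: the quotient is bounded by 8 and by \<open>1 / \<bar>x\<bar>\<close>.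
\<close>

lemma vp_quotient_square_le:
  assumes "0 < \<delta>" "\<delta> \<le> 1"
  shows "(vp_kernel (pi + \<delta>) (pi + 2 * \<delta>) x / \<delta>)\<^sup>2 \<le> 65 / (1 + x\<^sup>2)"
proof (cases "x = 0")
  case False
  define a b where "a = pi + \<delta>" and "b = pi + 2 * \<delta>"
  define v where "v = \<bar>vp_kernel a b x / \<delta>\<bar>"
  have v0: "v \<ge> 0" by (simp add: v_def)
  have v: "v * x\<^sup>2 * \<delta> = \<bar>cos (a * x) - cos (b * x)\<bar>"
    using False assms by (simp add: v_def vp_kernel_def abs_div)
  have "\<bar>b\<^sup>2 - a\<^sup>2\<bar> / 2 = (pi + 3 / 2 * \<delta>) * \<delta>"
    using assms by (simp add: a_def b_def power2_eq_square algebra_simps)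
  also have "\<dots> \<le> 8 * \<delta>" using assms pi_less_4 by (intro mult_right_mono) auto
  finally have "v * x\<^sup>2 * \<delta> \<le> 8 * \<delta> * x\<^sup>2"
    unfolding v by (intro order_trans[OF abs_cos_diff_le] mult_right_mono) auto
  then have "v \<le> 8" using False assms by simp
  then have 1: "v\<^sup>2 \<le> 64" using v0 power_mono[of v 8 2] by simp
  have "\<bar>cos (a * x) - cos (b * x)\<bar> = 2 * \<bar>sin ((a * x + b * x) / 2)\<bar> * \<bar>sin ((b * x - a * x) / 2)\<bar>"
    by (simp add: cos_diff_cos abs_mult)
  also have "\<dots> \<le> 2 * 1 * \<bar>(b * x - a * x) / 2\<bar>"
    by (intro mult_mono abs_sin_x_le_abs_x abs_sin_le_one) auto
  also have "\<dots> = \<delta> * \<bar>x\<bar>" using assms by (simp add: a_def b_def algebra_simps abs_mult)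
  finally have "v * x\<^sup>2 * \<delta> \<le> \<delta> * \<bar>x\<bar>" unfolding v .
  then have "v * \<bar>x\<bar> * \<bar>x\<bar> \<le> 1 * \<bar>x\<bar>" using assms by (simp add: power2_eq_square mult_ac)
  then have "v * \<bar>x\<bar> \<le> 1" using False by (simp only: mult_le_cancel_right)
  then have "(v * \<bar>x\<bar>)\<^sup>2 \<le> 1" using v0 by (simp add: power_le_one)
  then have 2: "v\<^sup>2 * x\<^sup>2 \<le> 1" by (simp add: power_mult_distrib)
  have "1 + x\<^sup>2 > 0" by (simp add: add_pos_nonneg)
  then have "v\<^sup>2 \<le> 65 / (1 + x\<^sup>2)" using 1 2 by (simp add: pos_le_divide_eq algebra_simps)
  then show ?thesis by (simp only: v_def a_def b_def power2_abs)
qed (simp add: vp_kernel_def)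

text \<open>
The quotient is a difference quotient in \<open>\<delta>\<close>, since the kernel vanishes for \<open>\<delta> = 0\<close>.
\<close>

lemma vp_quotient_tendsto:
  assumes "x \<noteq> 0"
  shows "((\<lambda>\<delta>. vp_kernel (pi + \<delta>) (pi + 2 * \<delta>) x / \<delta>) \<longlongrightarrow> sin (pi * x) / x) (at 0)"
proof -
  have "((\<lambda>\<delta>. vp_kernel (pi + \<delta>) (pi + 2 * \<delta>) x) has_field_derivative sin (pi * x) / x) (at 0)"
    unfolding vp_kernel_def using assms
    by (auto intro!: derivative_eq_intros simp: power2_eq_square field_simps)
  then show ?thesis by (simp add: has_field_derivative_iff vp_kernel_def)
qed

text \<open>
The kernels with \<open>a = pi + \<delta>\<close> and \<open>b = pi + 2 * \<delta>\<close> both exceed the type of \<open>F\<close>, so they reproduce \<open>F t\<close> exactly.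
Unlike the sinc kernel they are integrable, which is what makes the contour argument work. Dividing by \<open>\<delta>\<close> and
letting \<open>\<delta>\<close> tend to 0 turns them into the sinc kernel; dominated convergence applies because \<open>F\<close> and the
majorant of the quotients are square integrable.
\<close>

lemma PW_reproducing:
  assumes F: "F \<in> PW"
  shows "integrable lborel (\<lambda>x. nsinc (of_real (t - x)) * F (of_real x))"
    and "(LINT x|lborel. nsinc (of_real (t - x)) * F (of_real x)) = F (of_real t)"
proof -
  have hol: "F holomorphic_on UNIV" and L2: "integrable lborel (\<lambda>x::real. (norm (F (of_real x)))\<^sup>2)"
    using F by (auto simp: PW_def)
  note [measurable] = PW_restriction_measurable[OF F]
  show "integrable lborel (\<lambda>x. nsinc (of_real (t - x)) * F (of_real x))"
    by (rule integrable_L2_product(1)[OF _ _ nsinc_translate_L2(1) L2]) measurable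
  define G where "G = (\<lambda>z. F (of_real t + z))"
  have holG: "G holomorphic_on UNIV"
    unfolding G_def by (intro holomorphic_on_compose_gen[OF _ hol, unfolded o_def] holomorphic_intros) auto
  have GR: "G (of_real x) = F (of_real (t + x))" for x by (simp add: G_def)
  have L2G: "integrable lborel (\<lambda>x. (norm (G (of_real x)))\<^sup>2)"
    unfolding GR using lborel_integrable_real_affine_iff[of 1 "\<lambda>x. (norm (F (of_real x)))\<^sup>2" t] L2 by simp
  have [measurable]: "(\<lambda>x. G (of_real x)) \<in> borel_measurable borel" unfolding GR by measurable
  define \<delta> where "\<delta> = (\<lambda>n. 1 / real (Suc n))"
  have \<delta>: "0 < \<delta> n" "\<delta> n \<le> 1" for n by (auto simp: \<delta>_def)
  have \<delta>0: "\<delta> \<longlonglongrightarrow> 0" unfolding \<delta>_def by real_asymp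
  then have fl: "filterlim \<delta> (at 0) sequentially"
    using \<delta>(1) by (simp add: filterlim_at less_imp_neq[symmetric])
  have *: "(LINT x|lborel. G (of_real x) * of_real (vp_kernel (pi + \<delta> n) (pi + 2 * \<delta> n) x / \<delta> n)) = of_real pi * F (of_real t)" for n
  proof -
    have "pi < pi + \<delta> n" using \<delta>[of n] by simp
    then obtain M where "\<And>z. norm (F z) \<le> M * exp ((pi + \<delta> n) * \<bar>Im z\<bar>)"
      using PW_bound[OF F] by metis
    from this[of "of_real t + _"] have "norm (G z) \<le> M * exp ((pi + \<delta> n) * \<bar>Im z\<bar>)" for z
      unfolding G_def by simp
    from integral_times_vp_kernel(2)[OF holG this, of "pi + \<delta> n" "pi + 2 * \<delta> n"] \<delta>[of n]
    have "(LINT x|lborel. G (of_real x) * of_real (vp_kernel (pi + \<delta> n) (pi + 2 * \<delta> n) x))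
       = of_real (pi * \<delta> n) * F (of_real t)"
      by (simp add: G_def)
    then have "(LINT x|lborel. G (of_real x) * of_real (vp_kernel (pi + \<delta> n) (pi + 2 * \<delta> n) x)) / of_real (\<delta> n)
       = of_real pi * F (of_real t)"
      using \<delta>[of n] by simp
    then show ?thesis by (simp flip: integral_divide_zero)
  qed
  have "(\<lambda>n. LINT x|lborel. G (of_real x) * of_real (vp_kernel (pi + \<delta> n) (pi + 2 * \<delta> n) x / \<delta> n))
      \<longlonglongrightarrow> (LINT x|lborel. G (of_real x) * (of_real pi * nsinc (of_real x)))"
  proof (rule integral_dominated_convergence[where w = "\<lambda>x. (norm (G (of_real x)))\<^sup>2 + 65 / (1 + x\<^sup>2)"])
    show "integrable lborel (\<lambda>x. (norm (G (of_real x)))\<^sup>2 + 65 / (1 + x\<^sup>2))"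
      by (intro Bochner_Integration.integrable_add L2G integrable_inverse_one_plus_square)
    have "AE x in lborel. x \<noteq> (0::real)" by (rule AE_lborel_singleton)
    then show "AE x in lborel. (\<lambda>n. G (of_real x) * of_real (vp_kernel (pi + \<delta> n) (pi + 2 * \<delta> n) x / \<delta> n))
        \<longlonglongrightarrow> G (of_real x) * (of_real pi * nsinc (of_real x))"
    proof eventually_elim
      case (elim x)
      then have "of_real pi * nsinc (of_real x) = (of_real (sin (pi * x) / x) :: complex)"
        by (simp add: nsinc_of_real)
      show ?case unfolding \<open>of_real pi * nsinc (of_real x) = of_real (sin (pi * x) / x)\<close>
        by (intro tendsto_mult tendsto_const tendsto_of_real filterlim_compose[OF vp_quotient_tendsto[OF elim] fl])
    qed
    show "AE x in lborel. norm (G (of_real x) * of_real (vp_kernel (pi + \<delta> n) (pi + 2 * \<delta> n) x / \<delta> n))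
       \<le> (norm (G (of_real x)))\<^sup>2 + 65 / (1 + x\<^sup>2)" for n
    proof (intro AE_I2)
      fix x
      let ?v = "vp_kernel (pi + \<delta> n) (pi + 2 * \<delta> n) x / \<delta> n"
      have "norm (G (of_real x)) * \<bar>?v\<bar> \<le> (norm (G (of_real x)))\<^sup>2 + \<bar>?v\<bar>\<^sup>2"
        by (intro mult_le_sum_squares) auto
      then show "norm (G (of_real x) * of_real ?v) \<le> (norm (G (of_real x)))\<^sup>2 + 65 / (1 + x\<^sup>2)"
        using vp_quotient_square_le[OF \<delta>[of n], of x] unfolding norm_mult norm_of_real power2_abs by linarith
    qed
  qed measurable
  then have "of_real pi * F (of_real t) = (LINT x|lborel. G (of_real x) * (of_real pi * nsinc (of_real x)))"
    unfolding * by (simp add: LIMSEQ_const_iff)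
  also have "\<dots> = (LINT x|lborel. of_real pi * (G (of_real x) * nsinc (of_real x)))"
    by (simp add: mult_ac)
  also have "\<dots> = of_real pi * (LINT x|lborel. G (of_real x) * nsinc (of_real x))" by simp
  finally have "F (of_real t) = (LINT x|lborel. G (of_real x) * nsinc (of_real x))" by simp
  also have "\<dots> = (LINT x|lborel. nsinc (of_real (t - (t + 1 * x))) * F (of_real (t + 1 * x)))"
    unfolding GR using nsinc_minus by (simp add: mult.commute)
  also have "\<dots> = (LINT x|lborel. nsinc (of_real (t - x)) * F (of_real x))"
    using lborel_integral_real_affine[of 1 "\<lambda>x. nsinc (of_real (t - x)) * F (of_real x)" t] by simp
  finally show "(LINT x|lborel. nsinc (of_real (t - x)) * F (of_real x)) = F (of_real t)" ..
qed

section \<open>The Hausdorff operator as an integral operator\<close>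

text \<open>
The measure \<open>N\<close> may fail to be sigma-finite, but the measure with density \<open>\<bar>\<Phi>\<bar>\<close> is finite. Fubini is applied to that
measure, with the phase of \<open>\<Phi>\<close> moved into the integrand.
\<close>

lemma fubini_integrable_weight:
  fixes \<Phi> :: "'a \<Rightarrow> complex" and A :: "'a \<Rightarrow> real \<Rightarrow> complex"
  assumes \<Phi>: "integrable N \<Phi>"
    and meas: "case_prod A \<in> borel_measurable (N \<Otimes>\<^sub>M lborel)"
    and int: "\<And>u. u \<in> space N \<Longrightarrow> integrable lborel (A u)"
    and bound: "\<And>u. u \<in> space N \<Longrightarrow> (LINT x|lborel. norm (A u x)) \<le> D"
  shows "integrable lborel (\<lambda>x. LINT u|N. \<Phi> u * A u x)"
    and "(LINT x|lborel. LINT u|N. \<Phi> u * A u x) = (LINT u|N. \<Phi> u * (LINT x|lborel. A u x))"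
proof -
  note [measurable] = borel_measurable_integrable[OF \<Phi>] meas
  define \<nu> where "\<nu> = density N (\<lambda>u. ennreal (norm (\<Phi> u)))"
  have sets_\<nu>: "sets \<nu> = sets N" and space_\<nu>: "space \<nu> = space N" by (simp_all add: \<nu>_def)
  have "emeasure \<nu> (space \<nu>) = (\<integral>\<^sup>+u. ennreal (norm (\<Phi> u)) \<partial>N)"
    unfolding \<nu>_def by (simp add: emeasure_density nn_integral_set_ennreal cong: nn_integral_cong)
  also have "\<dots> < \<infinity>" using \<Phi> by (simp add: integrable_iff_bounded)
  finally interpret \<nu>: finite_measure \<nu> by (intro finite_measureI) simp
  interpret P: pair_sigma_finite \<nu> lborel by standard
  have sgn_mult: "norm (\<Phi> u) *\<^sub>R (sgn (\<Phi> u) * w) = \<Phi> u * w" for u w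
    by (cases "\<Phi> u = 0") (simp_all add: sgn_eq scaleR_conv_of_real field_simps)
  have sgn_le: "norm (sgn (\<Phi> u) * w) \<le> norm w" for u w
    by (auto simp: norm_mult norm_sgn)
  have [measurable_cong]: "sets \<nu> = sets N" by (rule sets_\<nu>)
  have mf: "(\<lambda>(u, x). sgn (\<Phi> u) * A u x) \<in> borel_measurable (\<nu> \<Otimes>\<^sub>M lborel)"
    by measurable
  have prod: "integrable (\<nu> \<Otimes>\<^sub>M lborel) (\<lambda>(u, x). sgn (\<Phi> u) * A u x)"
  proof (rule P.Fubini_integrable[OF mf])
    show "integrable \<nu> (\<lambda>u. LINT x|lborel. norm (case (u, x) of (u, x) \<Rightarrow> sgn (\<Phi> u) * A u x))"
    proof (rule \<nu>.integrable_const_bound[where B = D])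
      show "AE u in \<nu>. norm (LINT x|lborel. norm (case (u, x) of (u, x) \<Rightarrow> sgn (\<Phi> u) * A u x)) \<le> D"
      proof (rule AE_I2)
        fix u assume u: "u \<in> space \<nu>"
        have "(LINT x|lborel. norm (sgn (\<Phi> u) * A u x)) \<le> (LINT x|lborel. norm (A u x))"
          using u int by (intro integral_mono integrable_norm sgn_le integrable_mult_right) (auto simp: space_\<nu>)
        moreover have "(LINT x|lborel. norm (sgn (\<Phi> u) * A u x)) \<ge> 0"
          by (rule Bochner_Integration.integral_nonneg) simp
        ultimately show "norm (LINT x|lborel. norm (case (u, x) of (u, x) \<Rightarrow> sgn (\<Phi> u) * A u x)) \<le> D"
          using bound[of u] u by (simp add: space_\<nu>)
      qed
    qed measurable
    show "AE u in \<nu>. integrable lborel (\<lambda>x. case (u, x) of (u, x) \<Rightarrow> sgn (\<Phi> u) * A u x)"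
      using int by (intro AE_I2) (auto simp: space_\<nu>)
  qed
  have dens: "(LINT u|\<nu>. sgn (\<Phi> u) * f u) = (LINT u|N. \<Phi> u * f u)"
    if [measurable]: "f \<in> borel_measurable N" for f
    unfolding \<nu>_def by (subst integral_density) (simp_all add: sgn_mult)
  have inner: "(LINT u|\<nu>. sgn (\<Phi> u) * A u x) = (LINT u|N. \<Phi> u * A u x)" for x
    by (rule dens) measurable
  show "integrable lborel (\<lambda>x. LINT u|N. \<Phi> u * A u x)"
    using P.integrable_snd[OF prod] by (simp add: inner)
  have "(LINT x|lborel. LINT u|N. \<Phi> u * A u x) = (LINT u|\<nu>. LINT x|lborel. sgn (\<Phi> u) * A u x)"
    using P.Fubini_integral[OF prod] by (simp add: inner)
  also have "\<dots> = (LINT u|\<nu>. sgn (\<Phi> u) * (LINT x|lborel. A u x))"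
    by (simp add: integral_mult_right_zero)
  also have "\<dots> = (LINT u|N. \<Phi> u * (LINT x|lborel. A u x))"
    by (rule dens) measurable
  finally show "(LINT x|lborel. LINT u|N. \<Phi> u * A u x) = (LINT u|N. \<Phi> u * (LINT x|lborel. A u x))" .
qed

lemma completion_identity_measurable:
  assumes "sets \<mu> = sets (restrict_space borel {0<..})"
  shows "(\<lambda>u::real. u) \<in> borel_measurable (completion \<mu>)"
proof (rule measurable_completion)
  have "(\<lambda>u::real. u) \<in> borel_measurable (restrict_space borel {0<..})"
    by (rule measurable_restrict_space1) simp
  then show "(\<lambda>u::real. u) \<in> borel_measurable \<mu>"
    using measurable_cong_sets[OF assms refl] by blast
qed

text \<open>
The completion of \<open>\<mu>\<close> carries more sets than the Borel sets, so joint measurability is transported along the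
identity map.
\<close>

lemma borel_pair_measurable_imp:
  fixes N :: "real measure" and f :: "real \<times> real \<Rightarrow> complex"
  assumes id: "(\<lambda>u. u) \<in> borel_measurable N"
    and f: "f \<in> borel_measurable (borel \<Otimes>\<^sub>M borel)"
  shows "f \<in> borel_measurable (N \<Otimes>\<^sub>M lborel)"
proof -
  have "(\<lambda>p. (fst p, snd p)) \<in> (N \<Otimes>\<^sub>M lborel) \<rightarrow>\<^sub>M (borel \<Otimes>\<^sub>M borel)"
    by (intro measurable_Pair measurable_compose[OF measurable_fst id] measurable_compose[OF measurable_snd]) auto
  from measurable_compose[OF this f] show ?thesis by simp
qed

text \<open>
Integrate the reproducing formula \<open>F (t / u) = \<integral> nsinc (t / u - x) * F x dx\<close> against \<open>\<Phi> u\<close> and exchange the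
integrals. The inner integrals are bounded uniformly in \<open>u\<close>, since translation preserves the \<open>L\<^sup>2\<close> norm of the sinc
function.
\<close>

lemma K_op_eq_hausdorff_op:
  assumes \<mu>: "sets \<mu> = sets (restrict_space borel {0<..})"
    and \<Phi>: "integrable (completion \<mu>) \<Phi>" and F: "F \<in> PW"
  shows "integrable lborel (\<lambda>x. K_kernel \<Phi> \<mu> t x * F (of_real x))"
    and "K_op \<Phi> \<mu> (real_restriction F) t = hausdorff_op \<Phi> \<mu> F (of_real t)"
proof -
  note [measurable] = PW_restriction_measurable[OF F]
  have L2: "integrable lborel (\<lambda>x::real. (norm (F (of_real x)))\<^sup>2)" using F by (simp add: PW_def)
  define A where "A = (\<lambda>u x. nsinc (of_real (t / u - x)) * F (of_real x))"
  have meas: "case_prod A \<in> borel_measurable (completion \<mu> \<Otimes>\<^sub>M lborel)" unfolding A_def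
    by (rule borel_pair_measurable_imp[OF completion_identity_measurable[OF \<mu>]]) measurable
  have int: "integrable lborel (A u)" for u unfolding A_def by (rule PW_reproducing(1)[OF F])
  have "(LINT x|lborel. norm (A u x)) \<le> (LINT x|lborel. (norm (nsinc (of_real x)))\<^sup>2) + (LINT x|lborel. (norm (F (of_real x)))\<^sup>2)" for u
    unfolding A_def nsinc_translate_L2(2)[of "t / u", symmetric]
    by (rule integrable_L2_product(2)[OF _ _ nsinc_translate_L2(1) L2]) measurable
  note fubini = fubini_integrable_weight[OF \<Phi> meas int this]
   have "(LINT u|completion \<mu>. \<Phi> u * A u x) = K_kernel \<Phi> \<mu> t x * F (of_real x)" for x
    unfolding A_def K_kernel_def by (subst integral_mult_left_zero[symmetric]) (simp add: mult.assoc)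
  moreover have "(LINT x|lborel. A u x) = F (of_real t / of_real u)" for u
    unfolding A_def by (simp only: PW_reproducing(2)[OF F] of_real_divide)
  ultimately show "integrable lborel (\<lambda>x. K_kernel \<Phi> \<mu> t x * F (of_real x))"
    "K_op \<Phi> \<mu> (real_restriction F) t = hausdorff_op \<Phi> \<mu> F (of_real t)"
    using fubini by (simp_all add: K_op_def hausdorff_op_def real_restriction_def)
qed

section \<open>Test functions and test kernels\<close>

lemma integral_vp_kernel:
  "integrable lborel (vp_kernel a b)" "(LINT x|lborel. vp_kernel a b x) = pi * (\<bar>b\<bar> - \<bar>a\<bar>)"
proof -
  have abs: "vp_kernel a b x = vp_kernel \<bar>a\<bar> \<bar>b\<bar> x" for x
    unfolding vp_kernel_def by (simp add: abs_if)
  have 0: "norm (1::complex) \<le> 1 * exp (0 * \<bar>Im z\<bar>)" for z by simp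
  note R = integral_times_vp_kernel[OF holomorphic_on_const 0, of "\<bar>a\<bar>" "\<bar>b\<bar>"]
  have "integrable lborel (\<lambda>x. complex_of_real (vp_kernel a b x))"
    using R(1) by (simp add: abs[symmetric])
  then show int: "integrable lborel (vp_kernel a b)" by (simp add: complex_of_real_integrable_eq)
  have "complex_of_real (LINT x|lborel. vp_kernel a b x) = of_real (pi * (\<bar>b\<bar> - \<bar>a\<bar>))"
    using R(2) by (simp add: abs[symmetric])
  then show "(LINT x|lborel. vp_kernel a b x) = pi * (\<bar>b\<bar> - \<bar>a\<bar>)" by (simp only: of_real_eq_iff)
qed

text \<open>
The product formula for cosines reduces the integral to two kernels with shifted, possibly negative,
parameters.
\<close>

lemma integral_cos_times_vp_kernel:
  assumes "a \<ge> 0" "b \<ge> 0" "\<omega> \<ge> 0"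
  shows "integrable lborel (\<lambda>x. cos (\<omega> * x) * vp_kernel a b x)"
    and "(LINT x|lborel. cos (\<omega> * x) * vp_kernel a b x) = pi * (max b \<omega> - max a \<omega>)"
proof -
  have *: "cos (\<omega> * x) * vp_kernel a b x = (vp_kernel (\<omega> + a) (\<omega> + b) x + vp_kernel (\<omega> - a) (\<omega> - b) x) / 2" for x
    unfolding vp_kernel_def
    by (simp add: right_diff_distrib cos_times_cos distrib_right left_diff_distrib add_divide_distrib diff_divide_distrib)
  show "integrable lborel (\<lambda>x. cos (\<omega> * x) * vp_kernel a b x)"
    unfolding * by (intro integrable_divide Bochner_Integration.integrable_add integral_vp_kernel)
  have "(LINT x|lborel. cos (\<omega> * x) * vp_kernel a b x)
      = ((LINT x|lborel. vp_kernel (\<omega> + a) (\<omega> + b) x) + (LINT x|lborel. vp_kernel (\<omega> - a) (\<omega> - b) x)) / 2"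
    unfolding * integral_divide_zero by (subst Bochner_Integration.integral_add) (auto intro: integral_vp_kernel)
  also have "\<dots> = pi * ((\<bar>\<omega> + b\<bar> - \<bar>\<omega> + a\<bar> + \<bar>\<omega> - b\<bar> - \<bar>\<omega> - a\<bar>) / 2)"
    by (simp add: integral_vp_kernel(2) algebra_simps)
  also have "(\<bar>\<omega> + b\<bar> - \<bar>\<omega> + a\<bar> + \<bar>\<omega> - b\<bar> - \<bar>\<omega> - a\<bar>) / 2 = max b \<omega> - max a \<omega>"
    using assms by (auto simp: max_def abs_if)
  finally show "(LINT x|lborel. cos (\<omega> * x) * vp_kernel a b x) = pi * (max b \<omega> - max a \<omega>)" .
qed

lemma norm_nsinc_le: obtains C where "\<And>z. norm (nsinc z) \<le> C * exp (pi * norm z)"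
proof -
  have "compact (nsinc ` cball 0 1)"
    by (intro compact_continuous_image continuous_on_subset[OF holomorphic_on_imp_continuous_on[OF nsinc_holomorphic]]) auto
  then obtain C where C: "C > 0" "\<And>z. norm z \<le> 1 \<Longrightarrow> norm (nsinc z) \<le> C"
    by (auto dest!: compact_imp_bounded simp: bounded_pos)
  show thesis
  proof (rule that[of "C + 1"])
    fix z :: complex
    show "norm (nsinc z) \<le> (C + 1) * exp (pi * norm z)"
    proof (cases "norm z \<le> 1")
      case True
      then have "norm (nsinc z) * 1 \<le> (C + 1) * exp (pi * norm z)"
        using C(1) C(2)[of z] by (intro mult_mono) auto
      then show ?thesis by simp
    next
      case False
      then have "pi * norm z \<ge> 1 * 1" using pi_ge_two by (intro mult_mono) auto
      define w where "w = \<i> * (of_real pi * z)"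
      have nw: "norm w = pi * norm z" by (simp add: w_def norm_mult)
      have "sin (of_real pi * z) = (exp w - exp (- w)) / (2 * \<i>)" unfolding w_def by (rule sin_exp_eq)
      then have "norm (sin (of_real pi * z)) = norm (exp w - exp (- w)) / 2" by (simp add: norm_divide norm_mult)
      also have "\<dots> \<le> (exp (norm w) + exp (norm (- w))) / 2"
        by (intro divide_right_mono order_trans[OF norm_triangle_ineq4] add_mono norm_exp) auto
      finally have "norm (sin (of_real pi * z)) \<le> exp (pi * norm z)" by (simp add: nw)
      then have "norm (nsinc z) \<le> exp (pi * norm z) / (pi * norm z)"
        using False by (auto simp: nsinc_def norm_divide norm_mult divide_right_mono)
      also have "\<dots> \<le> exp (pi * norm z) / 1"
        using \<open>pi * norm z \<ge> 1 * 1\<close> by (intro divide_left_mono) auto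
      also have "\<dots> \<le> (C + 1) * exp (pi * norm z)" using C by simp
      finally show ?thesis .
    qed
  qed
qed

lemma cos_nsinc_holomorphic:
  "(\<lambda>z. cos (of_real \<xi> * z) * nsinc (of_real h * z)) holomorphic_on UNIV"
  by (intro holomorphic_intros holomorphic_on_compose_gen[OF _ nsinc_holomorphic, unfolded o_def]) auto

text \<open>
As \<open>h\<close> tends to 0 these functions approximate the pure frequency \<open>cos (\<xi> * x)\<close>, which is not square integrable
itself, and they stay bounded by 1 on the real line.
\<close>

lemma cos_nsinc_in_PW:
  assumes "h > 0" "\<bar>\<xi>\<bar> + pi * h \<le> pi"
  shows "(\<lambda>z. cos (of_real \<xi> * z) * nsinc (of_real h * z)) \<in> PW"
  unfolding PW_def
proof (intro CollectI conjI allI impI)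
  show "(\<lambda>z. cos (of_real \<xi> * z) * nsinc (of_real h * z)) holomorphic_on UNIV"
    by (rule cos_nsinc_holomorphic)
  obtain C where C: "\<And>z. norm (nsinc z) \<le> C * exp (pi * norm z)" by (rule norm_nsinc_le) auto
  have C0: "C \<ge> 0" using C[of 0] norm_ge_zero[of "nsinc 0"] by simp (meson order_trans norm_ge_zero)
  fix \<epsilon> :: real assume "\<epsilon> > 0"
  have "norm (cos (of_real \<xi> * z) * nsinc (of_real h * z)) \<le> C * exp ((pi + \<epsilon>) * norm z)" for z
  proof -
    have "norm (cos (of_real \<xi> * z) * nsinc (of_real h * z)) \<le> exp (\<bar>\<xi>\<bar> * norm z) * (C * exp (pi * h * norm z))"
      unfolding norm_mult using norm_cos_le[of "of_real \<xi> * z"] C[of "of_real h * z"] assms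
      by (intro mult_mono) (auto simp: norm_mult mult_ac)
    also have "\<dots> = C * exp ((\<bar>\<xi>\<bar> + pi * h) * norm z)" by (simp add: exp_add[symmetric] algebra_simps)
    also have "\<dots> \<le> C * exp ((pi + \<epsilon>) * norm z)"
      using assms \<open>\<epsilon> > 0\<close> C0 by (intro mult_left_mono) (auto intro!: mult_right_mono)
    finally show ?thesis .
  qed
  then show "\<exists>C. \<forall>z. norm (cos (of_real \<xi> * z) * nsinc (of_real h * z)) \<le> C * exp ((pi + \<epsilon>) * norm z)" by blast
next
  have "integrable lborel (\<lambda>x. (norm (nsinc (of_real (0 - x))))\<^sup>2)" by (rule nsinc_translate_L2)
  then have 1: "integrable lborel (\<lambda>x. (norm (nsinc (of_real (0 + h * x))))\<^sup>2)"
    using lborel_integrable_real_affine_iff[of h "\<lambda>x. (norm (nsinc (of_real x)))\<^sup>2" 0] assms(1)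
    by (simp add: nsinc_minus)
  show "integrable lborel (\<lambda>x. (norm (cos (of_real \<xi> * of_real x) * nsinc (of_real h * of_real x)))\<^sup>2)"
  proof (rule integrable_of_norm_le[OF 1])
    fix x :: real
    have "norm (cos (of_real \<xi> * of_real x :: complex)) \<le> 1"
      unfolding of_real_mult[symmetric] cos_of_real norm_of_real by simp
    then have "norm (cos (of_real \<xi> * of_real x) * nsinc (of_real h * of_real x)) \<le> norm (nsinc (of_real (0 + h * x)))"
      by (simp add: norm_mult mult_left_le_one_le)
    then show "norm ((norm (cos (of_real \<xi> * of_real x) * nsinc (of_real h * of_real x)))\<^sup>2) \<le> (norm (nsinc (of_real (0 + h * x))))\<^sup>2"
      by (simp add: power_mono)
  next
    show "(\<lambda>x. (norm (cos (of_real \<xi> * of_real x) * nsinc (of_real h * of_real x)))\<^sup>2) \<in> borel_measurable lborel"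
      using entire_restriction_measurable[OF cos_nsinc_holomorphic[of \<xi> h]] by measurable
  qed
qed

text \<open>
A function of the frequency \<open>\<omega>\<close>: it is 1 on \<open>[a, b]\<close>, 0 outside \<open>[a - \<delta>, b + \<delta>]\<close> and linear in between. The
differences of maxima are the form in which the cosine transforms of \<open>vp_kernel b (b + \<delta>)\<close> and
\<open>vp_kernel (a - \<delta>) a\<close> appear.
\<close>

definition trapezoid :: "real \<Rightarrow> real \<Rightarrow> real \<Rightarrow> real \<Rightarrow> real" where
  "trapezoid \<delta> a b \<omega> = ((max (b + \<delta>) \<omega> - max b \<omega>) - (max a \<omega> - max (a - \<delta>) \<omega>)) / \<delta>"

lemma abs_trapezoid_le_1: "\<delta> > 0 \<Longrightarrow> \<bar>trapezoid \<delta> a b \<omega>\<bar> \<le> 1"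
  unfolding trapezoid_def abs_div by (auto simp: divide_le_eq max_def)

lemma trapezoid_tendsto_indicator:
  assumes "a \<le> b" "\<And>n. \<delta> n > 0" "\<delta> \<longlonglongrightarrow> 0"
  shows "(\<lambda>n. trapezoid (\<delta> n) a b \<omega>) \<longlonglongrightarrow> indicator {a..b} \<omega>"
proof (rule tendsto_eventually)
  have sub: "eventually (\<lambda>n. \<delta> n < e) sequentially" if "e > 0" for e
    using assms(3) that by (rule order_tendstoD(2))
  consider "a \<le> \<omega>" "\<omega> \<le> b" | "\<omega> < a" | "\<omega> > b" by linarith
  then show "\<forall>\<^sub>F n in sequentially. trapezoid (\<delta> n) a b \<omega> = indicator {a..b} \<omega>"
  proof cases
    case 1
    then have "trapezoid (\<delta> n) a b \<omega> = 1" for n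
      using assms(1) assms(2)[of n] by (auto simp: trapezoid_def max_def)
    then show ?thesis using 1 by simp
  next
    case 2
    then have "eventually (\<lambda>n. \<delta> n < a - \<omega>) sequentially" by (intro sub) simp
    then show ?thesis
    proof eventually_elim
      case (elim n)
      then show ?case using 2 assms(1) assms(2)[of n] by (auto simp: trapezoid_def max_def)
    qed
  next
    case 3
    then have "eventually (\<lambda>n. \<delta> n < \<omega> - b) sequentially" by (intro sub) simp
    then show ?thesis
    proof eventually_elim
      case (elim n)
      then show ?case using 3 assms(1) assms(2)[of n] by (auto simp: trapezoid_def max_def)
    qed
  qed
qed

section \<open>The weight vanishes on the unit interval\<close>

text \<open>
Both kernels reproduce the same multiple of \<open>G 0\<close>, since the two parameters of each of them differ by \<open>\<delta>\<close>; their
difference has its spectrum above \<open>pi\<close>.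
\<close>

lemma PW_orthogonal_to_high_band:
  assumes G: "G \<in> PW" and a: "pi < a - \<delta>" "a \<le> b" "\<delta> > 0"
  shows "(LINT x|lborel. G (of_real x) * of_real (vp_kernel b (b + \<delta>) x - vp_kernel (a - \<delta>) a x)) = 0"
proof -
  obtain M where M: "\<And>z. norm (G z) \<le> M * exp ((a - \<delta>) * \<bar>Im z\<bar>)" using PW_bound[OF G a(1)] by metis
  have hol: "G holomorphic_on UNIV" using G by (simp add: PW_def)
  note R = integral_times_vp_kernel[OF hol M]
  have "(LINT x|lborel. G (of_real x) * of_real (vp_kernel b (b + \<delta>) x - vp_kernel (a - \<delta>) a x))
    = (LINT x|lborel. G (of_real x) * of_real (vp_kernel b (b + \<delta>) x)) - (LINT x|lborel. G (of_real x) * of_real (vp_kernel (a - \<delta>) a x))"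
    using a by (subst Bochner_Integration.integral_diff[symmetric]) (auto intro!: R(1) simp: algebra_simps)
  also have "\<dots> = 0" using a by (subst (1 2) R(2)) auto
  finally show ?thesis .
qed

text \<open>
Dilation by \<open>u\<close> turns the frequency \<open>\<xi>\<close> into \<open>\<xi> / u\<close>. Apply the operator to a function in \<^const>\<open>PW\<close> close to
\<open>cos (\<xi> * x)\<close> and test the result, which lies in \<^const>\<open>PW\<close>, against a kernel \<open>k\<close> with frequencies above \<open>pi\<close>: this gives 0.
Exchanging the integrals, it also gives the \<open>\<Phi>\<close>-average of the cosine transform of \<open>k\<close> at \<open>\<xi> / u\<close>.
\<close>

lemma weighted_trapezoid_integral_zero:
  fixes N :: "real measure"
  assumes \<Phi>: "integrable N \<Phi>" and id: "(\<lambda>u. u) \<in> borel_measurable N" and space: "space N = {0<..}"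
    and PW: "\<And>F. F \<in> PW \<Longrightarrow> \<exists>G\<in>PW. \<forall>t. (LINT u|N. \<Phi> u * F (of_real t / of_real u)) = G (of_real t)"
    and \<xi>: "0 \<le> \<xi>" "\<xi> < pi" and a: "pi < a - \<delta>" "a \<le> b" "\<delta> > 0"
  shows "(LINT u|N. \<Phi> u * of_real (trapezoid \<delta> a b (\<xi> / u))) = 0"
proof -
  note [measurable] = borel_measurable_integrable[OF \<Phi>]
  define k where "k = (\<lambda>x. vp_kernel b (b + \<delta>) x - vp_kernel (a - \<delta>) a x)"
  have k_int: "integrable lborel k"
    unfolding k_def by (intro Bochner_Integration.integrable_diff integral_vp_kernel)
  have [measurable]: "k \<in> borel_measurable borel" unfolding k_def by measurable
  \<comment> \<open>Small enough that \<open>F n\<close> below has type at most \<open>pi\<close>; this needs \<open>\<xi> < pi\<close>.\<close>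
  define h where "h = (\<lambda>n. (1 - \<xi> / pi) / real (Suc n))"
  have h: "h n > 0" "\<bar>\<xi>\<bar> + pi * h n \<le> pi" for n
  proof -
    show "h n > 0" using \<xi> by (simp add: h_def)
    have "h n \<le> (1 - \<xi> / pi) / 1" unfolding h_def using \<xi> by (intro divide_left_mono) auto
    then have "pi * h n \<le> pi * ((1 - \<xi> / pi) / 1)" by (intro mult_left_mono) auto
    then show "\<bar>\<xi>\<bar> + pi * h n \<le> pi" using \<xi> by (simp add: right_diff_distrib)
  qed
  have h0: "h \<longlonglongrightarrow> 0" unfolding h_def by real_asymp
  define F where "F = (\<lambda>n z. cos (of_real \<xi> * z) * nsinc (of_real (h n) * z))"
  have F_PW: "F n \<in> PW" for n unfolding F_def by (rule cos_nsinc_in_PW[OF h])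
  have FR: "F n (of_real x) = of_real (cos (\<xi> * x)) * nsinc (of_real (h n * x))" for n x
    unfolding F_def by (simp only: of_real_mult[symmetric] cos_of_real)
  have F1: "norm (F n (of_real x)) \<le> 1" for n x
    unfolding FR norm_mult norm_of_real
    using mult_mono[OF abs_cos_le_one[of "\<xi> * x"] norm_nsinc_of_real_le_1[of "h n * x"]] by simp
  define A where "A = (\<lambda>n u t. F n (of_real (t / u)) * of_real (k t))"
  have A_le: "norm (A n u t) \<le> \<bar>k t\<bar>" for n u t
    unfolding A_def norm_mult using mult_right_mono[OF F1[of n "t / u"], of "\<bar>k t\<bar>"] by simp
  have [measurable]: "A n u \<in> borel_measurable borel" for n u
    unfolding A_def FR by measurable
  have A_int: "integrable lborel (A n u)" for n u
    by (rule integrable_of_norm_le[OF integrable_abs[OF k_int] _ A_le]) simp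
  have A_norm: "(LINT t|lborel. norm (A n u t)) \<le> (LINT t|lborel. \<bar>k t\<bar>)" for n u
    by (intro integral_mono integrable_norm integrable_abs A_int k_int A_le)
  have A_meas: "case_prod (A n) \<in> borel_measurable (N \<Otimes>\<^sub>M lborel)" for n
    unfolding A_def FR by (rule borel_pair_measurable_imp[OF id]) measurable
  have zero: "(LINT u|N. \<Phi> u * (LINT t|lborel. A n u t)) = 0" for n
  proof -
    obtain G where G: "G \<in> PW" "\<And>t. (LINT u|N. \<Phi> u * F n (of_real t / of_real u)) = G (of_real t)"
      using PW[OF F_PW[of n]] by blast
    have "(LINT u|N. \<Phi> u * (LINT t|lborel. A n u t)) = (LINT t|lborel. LINT u|N. \<Phi> u * A n u t)"
      by (rule fubini_integrable_weight(2)[OF \<Phi> A_meas A_int A_norm, symmetric])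
    also have "(\<lambda>t. LINT u|N. \<Phi> u * A n u t) = (\<lambda>t. G (of_real t) * of_real (k t))"
    proof
      fix t
      show "(LINT u|N. \<Phi> u * A n u t) = G (of_real t) * of_real (k t)"
        unfolding A_def G(2)[symmetric] of_real_divide
        by (subst integral_mult_left_zero[symmetric]) (simp only: mult.assoc)
    qed
    also have "(LINT t|lborel. G (of_real t) * of_real (k t)) = 0"
      unfolding k_def by (rule PW_orthogonal_to_high_band[OF G(1) a])
    finally show ?thesis .
  qed
  have inner: "(\<lambda>n. LINT t|lborel. A n u t) \<longlonglongrightarrow> of_real (pi * \<delta> * trapezoid \<delta> a b (\<xi> / u))"
    if u: "u > 0" for u
  proof -
    have "(\<lambda>n. LINT t|lborel. A n u t) \<longlonglongrightarrow> (LINT t|lborel. complex_of_real (cos (\<xi> / u * t) * k t))"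
    proof (rule integral_dominated_convergence[OF _ _ integrable_abs[OF k_int]])
      show "AE t in lborel. norm (A n u t) \<le> \<bar>k t\<bar>" for n using A_le by simp
      show "AE t in lborel. (\<lambda>n. A n u t) \<longlonglongrightarrow> complex_of_real (cos (\<xi> / u * t) * k t)"
      proof (rule AE_I2)
        fix t
        have "(\<lambda>n. of_real (h n * (t / u)) :: complex) \<longlonglongrightarrow> of_real (0 * (t / u))"
          by (intro tendsto_intros h0)
        moreover have "isCont nsinc 0"
          using nsinc_holomorphic holomorphic_on_imp_continuous_on continuous_on_eq_continuous_at open_UNIV by blast
        ultimately have "(\<lambda>n. nsinc (of_real (h n * (t / u)))) \<longlonglongrightarrow> nsinc 0"
          by (intro isCont_tendsto_compose[of 0 nsinc]) auto
        then have "(\<lambda>n. of_real (cos (\<xi> * (t / u))) * nsinc (of_real (h n * (t / u))) * of_real (k t))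
            \<longlonglongrightarrow> of_real (cos (\<xi> * (t / u))) * nsinc 0 * complex_of_real (k t)"
          by (intro tendsto_intros)
        then show "(\<lambda>n. A n u t) \<longlonglongrightarrow> complex_of_real (cos (\<xi> / u * t) * k t)"
          unfolding A_def FR by (simp add: nsinc_def)
      qed
    qed measurable
    also have "(LINT t|lborel. complex_of_real (cos (\<xi> / u * t) * k t))
        = of_real (LINT t|lborel. cos (\<xi> / u * t) * k t)" by (rule integral_complex_of_real)
    also have "(LINT t|lborel. cos (\<xi> / u * t) * k t)
       = (LINT t|lborel. cos (\<xi> / u * t) * vp_kernel b (b + \<delta>) t) - (LINT t|lborel. cos (\<xi> / u * t) * vp_kernel (a - \<delta>) a t)"
      unfolding k_def right_diff_distrib using a u \<xi> pi_gt_zero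
      by (intro Bochner_Integration.integral_diff integral_cos_times_vp_kernel(1)) auto
    also have "\<dots> = pi * (max (b + \<delta>) (\<xi> / u) - max b (\<xi> / u)) - pi * (max a (\<xi> / u) - max (a - \<delta>) (\<xi> / u))"
      using a u \<xi> pi_gt_zero by (subst (1 2) integral_cos_times_vp_kernel(2)) auto
    also have "\<dots> = pi * \<delta> * trapezoid \<delta> a b (\<xi> / u)"
      using a by (simp add: trapezoid_def field_simps)
    finally show ?thesis .
  qed
  have "(\<lambda>n. LINT u|N. \<Phi> u * (LINT t|lborel. A n u t)) \<longlonglongrightarrow> (LINT u|N. \<Phi> u * of_real (pi * \<delta> * trapezoid \<delta> a b (\<xi> / u)))"
  proof (rule integral_dominated_convergence)
    show "integrable N (\<lambda>u. norm (\<Phi> u) * (LINT t|lborel. \<bar>k t\<bar>))" using \<Phi> by simp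
    have "(\<lambda>u. trapezoid \<delta> a b (\<xi> / u)) \<in> borel_measurable borel" unfolding trapezoid_def by measurable
    from measurable_compose[OF id this] have [measurable]: "(\<lambda>u. trapezoid \<delta> a b (\<xi> / u)) \<in> borel_measurable N" .
    show "(\<lambda>u. \<Phi> u * of_real (pi * \<delta> * trapezoid \<delta> a b (\<xi> / u))) \<in> borel_measurable N" by measurable
    have [measurable]: "(\<lambda>u. LINT t|lborel. A n u t) \<in> borel_measurable N" for n
      by (rule lborel.borel_measurable_lebesgue_integral[OF A_meas])
    show "(\<lambda>u. \<Phi> u * (LINT t|lborel. A n u t)) \<in> borel_measurable N" for n by measurable
    show "AE u in N. (\<lambda>n. \<Phi> u * (LINT t|lborel. A n u t)) \<longlonglongrightarrow> \<Phi> u * of_real (pi * \<delta> * trapezoid \<delta> a b (\<xi> / u))"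
      using inner space by (intro AE_I2 tendsto_mult tendsto_const) auto
    show "AE u in N. norm (\<Phi> u * (LINT t|lborel. A n u t)) \<le> norm (\<Phi> u) * (LINT t|lborel. \<bar>k t\<bar>)" for n
      unfolding norm_mult
      by (intro AE_I2 mult_left_mono order_trans[OF integral_norm_bound] A_norm) auto
  qed
  then have "0 = (LINT u|N. \<Phi> u * of_real (pi * \<delta> * trapezoid \<delta> a b (\<xi> / u)))"
    unfolding zero by (simp only: LIMSEQ_const_iff)
  also have "\<dots> = (LINT u|N. of_real (pi * \<delta>) * (\<Phi> u * of_real (trapezoid \<delta> a b (\<xi> / u))))"
    by (simp add: mult_ac)
  also have "\<dots> = of_real (pi * \<delta>) * (LINT u|N. \<Phi> u * of_real (trapezoid \<delta> a b (\<xi> / u)))"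
    by (rule integral_mult_right_zero)
  finally show ?thesis using a by simp
qed

text \<open>
For \<open>u\<close> in \<open>[p, q]\<close> with \<open>q < 1\<close> a frequency \<open>\<xi>\<close> below \<open>pi\<close> but above \<open>pi * q\<close> is moved to \<open>\<xi> / u > pi\<close>. Letting the
trapezoids over \<open>[\<xi> / q, \<xi> / p]\<close> shrink to the indicator isolates exactly these \<open>u\<close>.
\<close>

lemma weighted_interval_integral_zero:
  fixes N :: "real measure"
  assumes \<Phi>: "integrable N \<Phi>" and id: "(\<lambda>u. u) \<in> borel_measurable N" and space: "space N = {0<..}"
    and PW: "\<And>F. F \<in> PW \<Longrightarrow> \<exists>G\<in>PW. \<forall>t. (LINT u|N. \<Phi> u * F (of_real t / of_real u)) = G (of_real t)"
    and pq: "0 < p" "p \<le> q" "q < 1"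
  shows "(LINT u|N. \<Phi> u * indicator {p..q} u) = 0"
proof -
  note [measurable] = borel_measurable_integrable[OF \<Phi>]
  \<comment> \<open>The midpoint of \<open>pi * q\<close> and \<open>pi\<close>.\<close>
  define \<xi> where "\<xi> = pi * ((1 + q) / 2)"
  have "(1 + q) / 2 < 1" "(1 + q) / 2 > q" using pq by auto
  then have "pi * ((1 + q) / 2) < pi * 1" "pi * q < pi * ((1 + q) / 2)"
    by (intro mult_strict_left_mono; simp)+
  then have \<xi>: "0 \<le> \<xi>" "\<xi> < pi" "pi * q < \<xi>" using pq by (auto simp: \<xi>_def)
  then have "\<xi> > 0" using pq by (smt (verit) mult_pos_pos pi_gt_zero)
  define a b where "a = \<xi> / q" and "b = \<xi> / p"
  have "pi < a" unfolding a_def using \<xi> pq by (simp add: field_simps)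
  moreover have "a \<le> b" unfolding a_def b_def using \<xi> pq by (intro divide_left_mono) auto
  ultimately have ab: "pi < a" "a \<le> b" by auto
  \<comment> \<open>The offset 2 keeps \<open>a - \<delta> n\<close> strictly above \<open>pi\<close> for every \<open>n\<close>.\<close>
  define \<delta> where "\<delta> = (\<lambda>n. (a - pi) / real (n + 2))"
  have \<delta>: "\<delta> n > 0" "pi < a - \<delta> n" for n
  proof -
    show "\<delta> n > 0" using ab by (simp add: \<delta>_def)
    have "\<delta> n < (a - pi) / 1" unfolding \<delta>_def using ab by (intro divide_strict_left_mono) auto
    then show "pi < a - \<delta> n" by simp
  qed
  have \<delta>0: "\<delta> \<longlonglongrightarrow> 0" unfolding \<delta>_def by real_asymp
  have ind: "indicator {a..b} (\<xi> / u) = (indicator {p..q} u :: real)" if "u > 0" for u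
    using that pq \<open>\<xi> > 0\<close> by (auto simp: a_def b_def indicator_def field_simps)
  have meas: "(\<lambda>u. trapezoid d a b (\<xi> / u)) \<in> borel_measurable N" for d
  proof -
    have "(\<lambda>u. trapezoid d a b (\<xi> / u)) \<in> borel_measurable borel" unfolding trapezoid_def by measurable
    from measurable_compose[OF id this] show ?thesis .
  qed
  note [measurable] = this
  have [measurable]: "(\<lambda>u. indicator {p..q} u :: complex) \<in> borel_measurable N"
    by (rule measurable_compose[OF id]) simp
  have "(\<lambda>n. LINT u|N. \<Phi> u * of_real (trapezoid (\<delta> n) a b (\<xi> / u))) \<longlonglongrightarrow> (LINT u|N. \<Phi> u * indicator {p..q} u)"
  proof (rule integral_dominated_convergence[where w = "\<lambda>u. norm (\<Phi> u)"])
    show "AE u in N. (\<lambda>n. \<Phi> u * of_real (trapezoid (\<delta> n) a b (\<xi> / u))) \<longlonglongrightarrow> \<Phi> u * indicator {p..q} u"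
    proof (rule AE_I2)
      fix u assume "u \<in> space N"
      then have "u > 0" using space by simp
      have "(\<lambda>n. complex_of_real (trapezoid (\<delta> n) a b (\<xi> / u))) \<longlonglongrightarrow> of_real (indicator {a..b} (\<xi> / u))"
        by (intro tendsto_of_real trapezoid_tendsto_indicator ab \<delta> \<delta>0)
      also have "of_real (indicator {a..b} (\<xi> / u)) = (indicator {p..q} u :: complex)"
        unfolding ind[OF \<open>u > 0\<close>] by (simp add: indicator_def)
      finally show "(\<lambda>n. \<Phi> u * of_real (trapezoid (\<delta> n) a b (\<xi> / u))) \<longlonglongrightarrow> \<Phi> u * indicator {p..q} u"
        by (intro tendsto_intros)
    qed
    show "AE u in N. norm (\<Phi> u * of_real (trapezoid (\<delta> n) a b (\<xi> / u))) \<le> norm (\<Phi> u)" for n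
      unfolding norm_mult norm_of_real using abs_trapezoid_le_1[OF \<delta>(1)] by (intro AE_I2 mult_left_le) auto
  qed (use \<Phi> in auto)
  moreover have "(LINT u|N. \<Phi> u * of_real (trapezoid (\<delta> n) a b (\<xi> / u))) = 0" for n
    by (rule weighted_trapezoid_integral_zero[OF \<Phi> id space PW \<xi>(1,2) \<delta>(2) ab(2) \<delta>(1)])
  ultimately show ?thesis by (simp add: LIMSEQ_const_iff)
qed

text \<open>
The half-lines \<open>{..c}\<close> form an intersection-stable generator of the Borel sets; their traces on \<open>(0, 1)\<close> are exhausted
by the closed intervals of the hypothesis.
\<close>

lemma set_integral_unit_interval_zero:
  fixes N :: "real measure" and \<Phi> :: "real \<Rightarrow> complex"
  assumes \<Phi>: "integrable N \<Phi>" and id: "(\<lambda>u. u) \<in> borel_measurable N" and space: "space N = {0<..}"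
    and intervals: "\<And>p q. 0 < p \<Longrightarrow> p \<le> q \<Longrightarrow> q < 1 \<Longrightarrow> (LINT u|N. \<Phi> u * indicator {p..q} u) = 0"
    and A: "A \<in> sets borel"
  shows "(LINT u:(A \<inter> {0<..<1})|N. \<Phi> u) = 0"
proof -
  have sets: "B \<inter> {0<..<1} \<in> sets N" if "B \<in> sets borel" for B
  proof -
    have "B \<inter> {0<..<1} \<in> sets borel" using that by auto
    from measurable_sets[OF id this] show ?thesis using space by (simp add: vimage_def Int_def conj_comms cong: conj_cong)
  qed
  have int: "set_integrable N (B \<inter> {0<..<1}) \<Phi>" if "B \<in> sets borel" for B
    unfolding set_integrable_def by (rule integrable_mult_indicator[OF sets[OF that] \<Phi>])
  have basic: "(LINT u:({..c} \<inter> {0<..<1})|N. \<Phi> u) = 0" for c :: real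
  proof -
    define p where "p = (\<lambda>n. 1 / real (n + 2))"
    define q where "q = (\<lambda>n. min c (1 - p n))"
    have p: "0 < p n" "p n < 1" for n by (auto simp: p_def)
    have p0: "p \<longlonglongrightarrow> 0" unfolding p_def by real_asymp
    have meas: "(\<lambda>u. indicator {s..t} u :: complex) \<in> borel_measurable N" for s t
      by (rule measurable_compose[OF id]) simp
    have zero: "(LINT u|N. \<Phi> u * indicator {p n..q n} u) = 0" for n
    proof (cases "p n \<le> q n")
      case True
      have "q n < 1" using p[of n] by (simp add: q_def)
      with True show ?thesis using p by (intro intervals) auto
    qed simp
    have "(\<lambda>n. LINT u|N. \<Phi> u * indicator {p n..q n} u) \<longlonglongrightarrow> (LINT u|N. indicator ({..c} \<inter> {0<..<1}) u *\<^sub>R \<Phi> u)"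
    proof (rule integral_dominated_convergence[where w = "\<lambda>u. norm (\<Phi> u)"])
      show "(\<lambda>u. \<Phi> u * indicator {p n..q n} u) \<in> borel_measurable N" for n
        using borel_measurable_integrable[OF \<Phi>] meas by (intro borel_measurable_times)
      show "(\<lambda>u. indicator ({..c} \<inter> {0<..<1}) u *\<^sub>R \<Phi> u) \<in> borel_measurable N"
        using int[of "{..c}"] by (simp add: set_integrable_def)
      show "AE u in N. (\<lambda>n. \<Phi> u * indicator {p n..q n} u) \<longlonglongrightarrow> indicator ({..c} \<inter> {0<..<1}) u *\<^sub>R \<Phi> u"
      proof (rule AE_I2, rule tendsto_eventually)
        fix u assume "u \<in> space N"
        then have u: "u > 0" using space by simp
        show "\<forall>\<^sub>F n in sequentially. \<Phi> u * indicator {p n..q n} u = indicator ({..c} \<inter> {0<..<1}) u *\<^sub>R \<Phi> u"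
        proof (cases "u < 1")
          case True
          have "eventually (\<lambda>n. p n < min u (1 - u)) sequentially"
            using u True by (intro order_tendstoD(2)[OF p0]) auto
          then show ?thesis
            by eventually_elim (use u True in \<open>auto simp: q_def indicator_def\<close>)
        next
          case False
          have "u \<notin> {p n..q n}" for n using False p(1)[of n] by (simp add: q_def)
          then show ?thesis using False by (intro always_eventually allI) (simp add: indicator_def)
        qed
      qed
      show "AE u in N. norm (\<Phi> u * indicator {p n..q n} u) \<le> norm (\<Phi> u)" for n
        by (rule AE_I2) (auto simp: indicator_def)
    qed (use \<Phi> in simp)
    then show ?thesis unfolding zero by (simp add: LIMSEQ_const_iff set_lebesgue_integral_def)
  qed
  have UNIV_eq: "(LINT u:{0<..<1}|N. \<Phi> u) = 0"
  proof -
    have "{..1} \<inter> {0<..<1} = {0<..<1::real}" by auto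
    then show ?thesis using basic[of 1] by simp
  qed
  have borel: "sets borel = sigma_sets UNIV (range (\<lambda>a::real. {..a}))"
    by (subst borel_eq_atMost) (simp add: sets_measure_of)
  have "Int_stable (range (\<lambda>a::real. {..a}))"
    by (auto simp: Int_stable_def)
  moreover have "range (\<lambda>a::real. {..a}) \<subseteq> Pow UNIV" by simp
  moreover have "A \<in> sigma_sets UNIV (range (\<lambda>a::real. {..a}))" using A borel by simp
  ultimately show ?thesis
  proof (induction rule: sigma_sets_induct_disjoint)
    case (compl B)
    then have B: "B \<in> sets borel" "UNIV - B \<in> sets borel" by (auto simp: borel[symmetric])
    have "{0<..<1} = (B \<inter> {0<..<1}) \<union> ((UNIV - B) \<inter> {0<..<1::real})" by auto
    then have "(LINT u:{0<..<1}|N. \<Phi> u) = (LINT u:((B \<inter> {0<..<1}) \<union> ((UNIV - B) \<inter> {0<..<1}))|N. \<Phi> u)"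
      by simp
    also have "\<dots> = (LINT u:(B \<inter> {0<..<1})|N. \<Phi> u) + (LINT u:((UNIV - B) \<inter> {0<..<1})|N. \<Phi> u)"
      by (intro set_integral_Un int B) auto
    finally show ?case using compl UNIV_eq by simp
  next
    case (union B)
    then have B: "B i \<in> sets borel" for i by (auto simp: borel[symmetric])
    have "(\<Union>i. B i) \<inter> {0<..<1} = (\<Union>i. B i \<inter> {0<..<1})" by auto
    moreover have "(LINT u:(\<Union>i. B i \<inter> {0<..<1})|N. \<Phi> u) = (\<Sum>i. LINT u:(B i \<inter> {0<..<1})|N. \<Phi> u)"
    proof (rule lebesgue_integral_countable_add)
      show "set_integrable N (\<Union>i. B i \<inter> {0<..<1}) \<Phi>"
        using int[of "\<Union>i. B i"] B by (simp add: Int_UN_distrib2)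
    qed (use union B sets in \<open>auto simp: disjoint_family_on_def\<close>)
    ultimately show ?case using union by simp
  qed (use basic in \<open>auto simp: set_lebesgue_integral_def\<close>)
qed

text \<open>
The hypothesis covers only the sets of \<open>M\<close>, not those of its completion, so \<open>f\<close> is first replaced by an
\<open>M\<close>-measurable function that agrees with it almost everywhere.
\<close>

lemma completion_AE_zero_of_set_integrals:
  fixes f :: "'a \<Rightarrow> real"
  assumes f: "integrable (completion M) f"
    and zero: "\<And>A. A \<in> sets M \<Longrightarrow> (LINT x:A|completion M. f x) = 0"
  shows "AE x in completion M. f x = 0"
proof -
  obtain g where g[measurable]: "g \<in> borel_measurable M" and "AE x in M. f x = g x"
    using completion_ex_borel_measurable_real[OF borel_measurable_integrable[OF f]] by blast
  then have fg: "AE x in completion M. f x = g x" by (intro AE_completion)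
  have g': "g \<in> borel_measurable (completion M)" using g by (rule measurable_completion)
  have "integrable (completion M) g"
    using f integrable_cong_AE[OF borel_measurable_integrable[OF f] g' fg] by simp
  then have gi: "integrable M g" using integrable_completion[OF g] by simp
  have "AE x in M. g x = 0"
  proof (rule density_unique_real[OF gi])
    show "integrable M (\<lambda>x. 0::real)" by simp
    fix A assume A[measurable]: "A \<in> sets M"
    have "(LINT x:A|M. g x) = (LINT x:A|completion M. g x)"
      unfolding set_lebesgue_integral_def by (rule integral_completion[symmetric]) measurable
    also have "\<dots> = (LINT x:A|completion M. f x)"
      unfolding set_lebesgue_integral_def
    proof (rule integral_cong_AE)
      have Ac: "A \<in> sets (completion M)" using A by simp
      show "(\<lambda>x. indicator A x *\<^sub>R g x) \<in> borel_measurable (completion M)"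
           "(\<lambda>x. indicator A x *\<^sub>R f x) \<in> borel_measurable (completion M)"
        by (intro borel_measurable_scaleR borel_measurable_indicator Ac g' borel_measurable_integrable[OF f])+
      show "AE x in completion M. indicator A x *\<^sub>R g x = indicator A x *\<^sub>R f x"
        using fg by eventually_elim simp
    qed
    finally show "(LINT x:A|M. g x) = (LINT x:A|M. 0)" using zero[OF A] by (simp add: set_lebesgue_integral_def)
  qed
  then have "AE x in completion M. g x = 0" by (rule AE_completion)
  with fg show ?thesis by eventually_elim simp
qed

text \<open>
For \<open>u < 1\<close> the dilation spreads the spectrum beyond \<open>[-pi, pi]\<close>. No cancellation between different \<open>u\<close> can keep all
images in \<^const>\<open>PW\<close>, as each interval of such \<open>u\<close> can be tested separately.
\<close>

lemma weight_vanishes_below_one: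
  assumes \<mu>: "sets \<mu> = sets (restrict_space borel {0<..})"
    and \<Phi>: "integrable (completion \<mu>) \<Phi>"
    and PW: "\<And>F. F \<in> PW \<Longrightarrow> \<exists>G\<in>PW. \<forall>t. hausdorff_op \<Phi> \<mu> F (of_real t) = G (of_real t)"
  shows "AE u in completion \<mu>. u < 1 \<longrightarrow> \<Phi> u = 0"
proof -
  have space: "space \<mu> = {0<..}" using sets_eq_imp_space_eq[OF \<mu>] by (simp add: space_restrict_space)
  note id = completion_identity_measurable[OF \<mu>]
  have zero: "(LINT u:(A \<inter> {0<..<1})|completion \<mu>. \<Phi> u) = 0" if "A \<in> sets borel" for A
    by (rule set_integral_unit_interval_zero[OF \<Phi> id _ weighted_interval_integral_zero[OF \<Phi> id] that])
       (use space PW in \<open>auto simp: hausdorff_op_def\<close>)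
  have int: "integrable (completion \<mu>) (\<lambda>u. indicator (A \<inter> {0<..<1}) u *\<^sub>R \<Phi> u)" if "A \<in> sets borel" for A
  proof (rule integrable_mult_indicator[OF _ \<Phi>])
    have "A \<inter> {0<..<1} = (A \<inter> {0<..<1}) \<inter> {0<..}" by auto
    moreover have "A \<inter> {0<..<1} \<in> sets borel" using that by auto
    ultimately have "A \<inter> {0<..<1} \<in> sets \<mu>" unfolding \<mu> sets_restrict_space by blast
    then show "A \<inter> {0<..<1} \<in> sets (completion \<mu>)" by simp
  qed
  have part: "AE u in completion \<mu>. indicator {0<..<1} u * L (\<Phi> u) = 0" if L: "bounded_linear L" for L :: "complex \<Rightarrow> real"
  proof (rule completion_AE_zero_of_set_integrals)
    interpret L: bounded_linear L by (rule L)
    have eq: "indicator A u *\<^sub>R (indicator {0<..<1} u * L (\<Phi> u)) = L (indicator (A \<inter> {0<..<1}) u *\<^sub>R \<Phi> u)" for A u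
      by (simp add: indicator_def L.scaleR L.zero)
    show "integrable (completion \<mu>) (\<lambda>u. indicator {0<..<1} u * L (\<Phi> u))"
      using integrable_bounded_linear[OF L int[of UNIV]] eq[of UNIV] by simp
    fix A assume "A \<in> sets \<mu>"
    then have A: "A \<in> sets borel" unfolding \<mu> sets_restrict_space by auto
    have "(LINT u:A|completion \<mu>. indicator {0<..<1} u * L (\<Phi> u)) = L (LINT u:(A \<inter> {0<..<1})|completion \<mu>. \<Phi> u)"
      unfolding set_lebesgue_integral_def eq by (rule integral_bounded_linear[OF L int[OF A]])
    then show "(LINT u:A|completion \<mu>. indicator {0<..<1} u * L (\<Phi> u)) = 0"
      by (simp add: zero[OF A] L.zero)
  qed
  have "AE u in completion \<mu>. u \<in> space (completion \<mu>)" by (rule AE_space)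
  with part[OF bounded_linear_Re] part[OF bounded_linear_Im] show ?thesis
    by eventually_elim (auto simp: indicator_def complex_eq_iff space split: if_splits)
qed

section \<open>Averages of contracting dilations\<close>

text \<open>
For \<open>u \<ge> 1\<close> the point \<open>z / u\<close> is no farther from 0 than \<open>z\<close>, so the growth bound for \<open>F\<close> passes to the average.
\<close>

lemma dilation_average_exponential_type:
  fixes N :: "real measure" and \<Phi> :: "real \<Rightarrow> complex"
  assumes \<Phi>: "integrable N \<Phi>" and id: "(\<lambda>u. u) \<in> borel_measurable N"
    and supp: "AE u in N. u < 1 \<longrightarrow> \<Phi> u = 0"
    and hol: "F holomorphic_on UNIV" and bound: "\<And>z. norm (F z) \<le> C * exp (a * norm z)" and a: "a \<ge> 0"
  shows "integrable N (\<lambda>u. \<Phi> u * F (z / of_real u))"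
    and "norm (LINT u|N. \<Phi> u * F (z / of_real u)) \<le> C * (LINT u|N. norm (\<Phi> u)) * exp (a * norm z)"
proof -
  have C0: "C \<ge> 0" using bound[of 0] norm_ge_zero[of "F 0"] by simp (meson order_trans norm_ge_zero)
  have [measurable]: "F \<in> borel_measurable borel"
    using hol by (intro borel_measurable_continuous_onI holomorphic_on_imp_continuous_on)
  have "(\<lambda>u. F (z / of_real u)) \<in> borel_measurable N"
    by (rule measurable_compose[OF id]) measurable
  then have meas: "(\<lambda>u. \<Phi> u * F (z / of_real u)) \<in> borel_measurable N"
    using borel_measurable_integrable[OF \<Phi>] by (intro borel_measurable_times)
  have le: "AE u in N. norm (\<Phi> u * F (z / of_real u)) \<le> norm (\<Phi> u) * (C * exp (a * norm z))"
    using supp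
  proof eventually_elim
    case (elim u)
    show ?case
    proof (cases "u < 1")
      case False
      then have "norm (z / of_real u) \<le> norm z / 1"
        unfolding norm_divide by (intro divide_left_mono) auto
      then have "C * exp (a * norm (z / of_real u)) \<le> C * exp (a * norm z)"
        using C0 a by (intro mult_left_mono) (auto intro: mult_left_mono)
      then have "norm (F (z / of_real u)) \<le> C * exp (a * norm z)" using bound order_trans by blast
      then show ?thesis unfolding norm_mult by (intro mult_left_mono) auto
    qed (use elim in simp)
  qed
  have int_r: "integrable N (\<lambda>u. norm (\<Phi> u) * (C * exp (a * norm z)))" using \<Phi> by simp
  show "integrable N (\<lambda>u. \<Phi> u * F (z / of_real u))"
    by (rule Bochner_Integration.integrable_bound[OF int_r meas])
       (use le C0 in \<open>auto simp: abs_mult\<close>)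
  then have "norm (LINT u|N. \<Phi> u * F (z / of_real u)) \<le> (LINT u|N. norm (\<Phi> u) * (C * exp (a * norm z)))"
    by (intro order_trans[OF integral_norm_bound] integral_mono_AE int_r le) auto
  then show "norm (LINT u|N. \<Phi> u * F (z / of_real u)) \<le> C * (LINT u|N. norm (\<Phi> u)) * exp (a * norm z)"
    by (simp add: mult_ac)
qed

text \<open>
The power series of \<open>F\<close> is integrated term by term: its \<open>n\<close>-th coefficient is multiplied by the average of \<open>u\<^sup>-\<^sup>n\<close>,
which is at most the \<open>L\<^sup>1\<close> norm of \<open>\<Phi>\<close>, so the new series converges everywhere.
\<close>

lemma dilation_average_entire:
  fixes N :: "real measure" and \<Phi> :: "real \<Rightarrow> complex"
  assumes \<Phi>: "integrable N \<Phi>" and id: "(\<lambda>u. u) \<in> borel_measurable N"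
    and supp: "AE u in N. u < 1 \<longrightarrow> \<Phi> u = 0" and hol: "F holomorphic_on UNIV"
  shows "(\<lambda>z. LINT u|N. \<Phi> u * F (z / of_real u)) holomorphic_on UNIV"
proof -
  note [measurable] = borel_measurable_integrable[OF \<Phi>]
  define c where "c = (\<lambda>n. (deriv ^^ n) F 0 / fact n)"
  have F: "(\<lambda>n. c n * w ^ n) sums F w" for w
    using holomorphic_power_series[of F 0 "norm w + 1" w] holomorphic_on_subset[OF hol] by (simp add: c_def)
  define H where "H = (\<lambda>z. LINT u|N. \<Phi> u * F (z / of_real u))"
  have H: "(\<lambda>n. (LINT u|N. \<Phi> u * (c n / of_real u ^ n)) * z ^ n) sums H z" for z
  proof -
    have "summable (\<lambda>n. c n * of_real (norm z + 1) ^ n)" using F sums_summable by blast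
    then have sm: "summable (\<lambda>n. norm (c n * z ^ n))" by (rule powser_insidea) simp
    define f where "f = (\<lambda>n u. \<Phi> u * (c n / of_real u ^ n) * z ^ n)"
    have meas: "f n \<in> borel_measurable N" for n
    proof -
      have "(\<lambda>u. c n / of_real u ^ n) \<in> borel_measurable N" by (rule measurable_compose[OF id]) measurable
      then show ?thesis unfolding f_def by measurable
    qed
    have f_le: "AE u in N. \<forall>n. norm (f n u) \<le> norm (\<Phi> u) * norm (c n * z ^ n)"
      using supp
    proof eventually_elim
      case (elim u)
      show ?case
      proof (cases "u < 1")
        case False
        have "norm (c n / of_real u ^ n) \<le> norm (c n) / 1" for n
          unfolding norm_divide norm_power using False by (intro divide_left_mono) auto
        then have "norm (\<Phi> u) * norm (c n / of_real u ^ n) * norm (z ^ n) \<le> norm (\<Phi> u) * (norm (c n) / 1) * norm (z ^ n)" for n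
          by (intro mult_right_mono mult_left_mono) auto
        then show ?thesis by (simp only: f_def norm_mult mult.assoc div_by_1 simp_thms)
      qed (use elim in \<open>simp add: f_def\<close>)
    qed
    have int: "integrable N (f n)" for n
      by (rule Bochner_Integration.integrable_bound[OF integrable_mult_left[OF integrable_norm[OF \<Phi>], of "norm (c n * z ^ n)"] meas])
         (use f_le in \<open>eventually_elim, auto simp: abs_mult\<close>)
    have "(\<lambda>n. integral\<^sup>L N (f n)) sums (LINT u|N. (\<Sum>n. f n u))"
    proof (rule sums_integral[OF int])
      show "AE u in N. summable (\<lambda>n. norm (f n u))"
        using f_le
      proof eventually_elim
        case (elim u)
        show ?case
          by (rule summable_comparison_test'[OF summable_mult[OF sm, of "norm (\<Phi> u)"]]) (use elim in auto)
      qed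
      have "norm (LINT u|N. norm (f n u)) \<le> (LINT u|N. norm (\<Phi> u)) * norm (c n * z ^ n)" for n
      proof -
        have "(LINT u|N. norm (f n u)) \<le> (LINT u|N. norm (\<Phi> u) * norm (c n * z ^ n))"
          using \<Phi> f_le by (intro integral_mono_AE integrable_norm int) auto
        moreover have "(LINT u|N. norm (f n u)) \<ge> 0" by (rule Bochner_Integration.integral_nonneg) simp
        ultimately show ?thesis by simp
      qed
      then show "summable (\<lambda>n. LINT u|N. norm (f n u))"
        by (intro summable_comparison_test'[OF summable_mult[OF sm]]) auto
    qed
    moreover have "(\<Sum>n. f n u) = \<Phi> u * F (z / of_real u)" for u
    proof -
      have "f n u = \<Phi> u * (c n * (z / of_real u) ^ n)" for n by (simp add: f_def power_divide)
      then have "(\<lambda>n. f n u) sums (\<Phi> u * F (z / of_real u))"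
        using sums_mult[OF F[of "z / of_real u"], of "\<Phi> u"] by simp
      then show ?thesis by (rule sums_unique[symmetric])
    qed
    moreover have "integral\<^sup>L N (f n) = (LINT u|N. \<Phi> u * (c n / of_real u ^ n)) * z ^ n" for n
      unfolding f_def by (rule integral_mult_left_zero)
    ultimately show ?thesis by (simp add: H_def)
  qed
  have "H holomorphic_on ball 0 r" for r
    by (rule power_series_holomorphic[where a = "\<lambda>n. LINT u|N. \<Phi> u * (c n / of_real u ^ n)"]) (use H in simp)
  then have "H field_differentiable at z" for z
    using holomorphic_on_imp_differentiable_at[of H "ball 0 (norm z + 1)" z] by simp
  then show ?thesis unfolding H_def[symmetric] by (simp add: holomorphic_on_def)
qed

section \<open>Equivalence of the two boundedness properties\<close>

lemma hausdorff_bounded_imp_K_bounded: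
  assumes \<mu>: "sets \<mu> = sets (restrict_space borel {0<..})"
    and \<Phi>: "integrable (completion \<mu>) \<Phi>" and H: "hausdorff_bounded_in_PW \<Phi> \<mu>"
  shows "K_bounded_in_PW \<Phi> \<mu>"
proof -
  note id = completion_identity_measurable[OF \<mu>]
  have K: "K_op \<Phi> \<mu> (real_restriction F) = real_restriction (hausdorff_op \<Phi> \<mu> F)" if "F \<in> PW" for F
    using K_op_eq_hausdorff_op(2)[OF \<mu> \<Phi> that] by (auto simp: real_restriction_def)
  have "integrable (completion \<mu>) (\<lambda>u. \<Phi> u * nsinc (of_real (t / u - x)))" for t x
  proof (rule Bochner_Integration.integrable_bound[OF \<Phi>])
    have "(\<lambda>u. nsinc (of_real (t / u - x))) \<in> borel_measurable (completion \<mu>)"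
      by (rule measurable_compose[OF id]) measurable
    then show "(\<lambda>u. \<Phi> u * nsinc (of_real (t / u - x))) \<in> borel_measurable (completion \<mu>)"
      using borel_measurable_integrable[OF \<Phi>] by (intro borel_measurable_times)
    show "AE u in completion \<mu>. norm (\<Phi> u * nsinc (of_real (t / u - x))) \<le> norm (\<Phi> u)"
      unfolding norm_mult by (intro AE_I2 mult_left_le norm_nsinc_of_real_le_1) simp
  qed
  moreover have "integrable lborel (\<lambda>x. K_kernel \<Phi> \<mu> t x * real_restriction F x)" if "F \<in> PW" for F t
    using K_op_eq_hausdorff_op(1)[OF \<mu> \<Phi> that] by (simp add: real_restriction_def)
  moreover obtain D where "\<forall>F\<in>PW. L2_norm_real (real_restriction (hausdorff_op \<Phi> \<mu> F)) \<le> D * L2_norm_real (real_restriction F)"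
    using H unfolding hausdorff_bounded_in_PW_def by blast
  moreover have "\<forall>F\<in>PW. hausdorff_op \<Phi> \<mu> F \<in> PW" using H unfolding hausdorff_bounded_in_PW_def by blast
  ultimately show ?thesis unfolding K_bounded_in_PW_def by (auto simp: K)
qed

text \<open>
Boundedness of the integral operator concerns values on the real line only. The values at complex points, where
\<open>F (z / u)\<close> may grow like $e^{\pi |z| / u}$, are under control because \<open>\<Phi>\<close> lives on \<open>[1, \<infinity>)\<close>. The image
is then entire of exponential type, and it is square integrable because it agrees on the real line with an element
of \<^const>\<open>PW\<close>.
\<close>

lemma K_bounded_imp_hausdorff_bounded:
  assumes \<mu>: "sets \<mu> = sets (restrict_space borel {0<..})"
    and \<Phi>: "integrable (completion \<mu>) \<Phi>" and K: "K_bounded_in_PW \<Phi> \<mu>"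
  shows "hausdorff_bounded_in_PW \<Phi> \<mu>"
proof -
  note id = completion_identity_measurable[OF \<mu>]
  have HK: "real_restriction (hausdorff_op \<Phi> \<mu> F) = K_op \<Phi> \<mu> (real_restriction F)" if "F \<in> PW" for F
    using K_op_eq_hausdorff_op(2)[OF \<mu> \<Phi> that] by (auto simp: real_restriction_def)
  have G: "\<exists>G\<in>PW. real_restriction (hausdorff_op \<Phi> \<mu> F) = real_restriction G" if "F \<in> PW" for F
    using K that unfolding K_bounded_in_PW_def HK[OF that] by blast
  have "\<exists>G\<in>PW. \<forall>t. hausdorff_op \<Phi> \<mu> F (of_real t) = G (of_real t)" if "F \<in> PW" for F
    using G[OF that] unfolding real_restriction_def fun_eq_iff by blast
  then have supp: "AE u in completion \<mu>. u < 1 \<longrightarrow> \<Phi> u = 0" by (rule weight_vanishes_below_one[OF \<mu> \<Phi>])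
  have growth: "\<exists>C. \<forall>z. norm (F z) \<le> C * exp ((pi + \<epsilon>) * norm z)" if "F \<in> PW" "\<epsilon> > 0" for F \<epsilon>
    using that by (simp add: PW_def)
  have hol: "F holomorphic_on UNIV" if "F \<in> PW" for F using that by (simp add: PW_def)
  have int: "integrable (completion \<mu>) (\<lambda>u. \<Phi> u * F (z / of_real u))" if F: "F \<in> PW" for F z
  proof -
    obtain C where "\<And>z. norm (F z) \<le> C * exp ((pi + 1) * norm z)" using growth[OF F, of 1] by auto
    then show ?thesis
      by (rule dilation_average_exponential_type(1)[OF \<Phi> id supp hol[OF F]]) simp
  qed
  have mem: "hausdorff_op \<Phi> \<mu> F \<in> PW" if F: "F \<in> PW" for F
    unfolding PW_def
  proof (intro CollectI conjI allI impI)
    show "hausdorff_op \<Phi> \<mu> F holomorphic_on UNIV"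
      using dilation_average_entire[OF \<Phi> id supp hol[OF F]] unfolding hausdorff_op_def .
    fix \<epsilon> :: real assume e: "\<epsilon> > 0"
    obtain C where C: "\<And>z. norm (F z) \<le> C * exp ((pi + \<epsilon>) * norm z)" using growth[OF F e] by auto
    have "pi + \<epsilon> \<ge> 0" using e pi_gt_zero by linarith
    from dilation_average_exponential_type(2)[OF \<Phi> id supp hol[OF F] C this]
    show "\<exists>C. \<forall>z. norm (hausdorff_op \<Phi> \<mu> F z) \<le> C * exp ((pi + \<epsilon>) * norm z)"
      unfolding hausdorff_op_def by blast
  next
    obtain G where "G \<in> PW" "real_restriction (hausdorff_op \<Phi> \<mu> F) = real_restriction G" using G[OF F] by blast
    then show "integrable lborel (\<lambda>x. (norm (hausdorff_op \<Phi> \<mu> F (of_real x)))\<^sup>2)"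
      by (simp add: PW_def real_restriction_def fun_eq_iff)
  qed
  obtain D where "\<forall>f\<in>real_restriction ` PW. L2_norm_real (K_op \<Phi> \<mu> f) \<le> D * L2_norm_real f"
    using K unfolding K_bounded_in_PW_def by blast
  then have "\<forall>F\<in>PW. L2_norm_real (real_restriction (hausdorff_op \<Phi> \<mu> F)) \<le> D * L2_norm_real (real_restriction F)"
    by (simp add: HK)
  then show ?thesis unfolding hausdorff_bounded_in_PW_def using int mem by blast
qed

theorem corollary14:
  fixes \<mu> :: "real measure" and \<Phi> :: "real \<Rightarrow> complex"
  assumes "regular_borel_measure \<mu>"
    and "integrable (completion \<mu>) \<Phi>"
  shows "(hausdorff_bounded_in_PW \<Phi> \<mu> \<longleftrightarrow> K_bounded_in_PW \<Phi> \<mu>) \<and>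
         (hausdorff_bounded_in_PW \<Phi> \<mu> \<longrightarrow>
            (\<forall>F\<in>PW. \<forall>t::real. hausdorff_op \<Phi> \<mu> F (complex_of_real t) =
               (LINT x|lborel. K_kernel \<Phi> \<mu> t x * F (complex_of_real x))))"
proof -
  have \<mu>: "sets \<mu> = sets (restrict_space borel {0<..})"
    using assms(1) by (simp add: regular_borel_measure_def)
  have "hausdorff_op \<Phi> \<mu> F (of_real t) = (LINT x|lborel. K_kernel \<Phi> \<mu> t x * F (of_real x))" if "F \<in> PW" for F t
    using K_op_eq_hausdorff_op(2)[OF \<mu> assms(2) that] by (simp add: K_op_def real_restriction_def)
  then show ?thesis
    using hausdorff_bounded_imp_K_bounded[OF \<mu> assms(2)] K_bounded_imp_hausdorff_bounded[OF \<mu> assms(2)] by blast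
qed

end
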